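(* Let $\mathfrak B$ be a generalized model in the narrow sense with universe $\beta X$ whose interpretation is pseudo-principal on functional symbols, with principal submodel $\mathfrak A$ (universe $X$), and let $\mathfrak U=I(\mathfrak B)$. Let $\mathfrak V$ be a generalized model in the wide sense in the same signature with universe $Y$ carrying a compact Hausdorff topology (and fixed topologies on $Y^{Y^n}$ and $\mathcal P(Y^n)$), let $h:X\to Y$, and suppose that for every $n$ the interpretation in $\mathfrak V$ takes all $n$-ary functional symbols to ultrafilters having limits in $RC_{h``X}(Y^n,Y)$ and all $n$-ary predicate symbols to ultrafilters having limits in $\{S\subseteq Y^n:S$ is closed$\}$, where $Y^n$ carries the product topology. Then the following are equivalent: (i) $h$ is a homomorphism of $\mathfrak A$ into $\mathfrak V$; (ii) $\tilde h$ is a homomorphism of $\mathfrak U$ into $\mathfrak V$; (iii) $\tilde h$ is a homomorphism of $\widetilde{\mathfrak A}$ into $\mathfrak V$; (iv) $\tilde h$ is a homomorphism of $\mathfrak A^*$ into $\mathfrak V$.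
   Context: $\beta X$: ultrafilters on $X$, $X\subseteq\beta X$ via principal ultrafilters, standard compact Hausdorff topology; $(\forall^{\mathfrak u}x)\varphi$ means $\{x:\varphi\}\in\mathfrak u$; $(\beta X)^n$ has the product topology. $\tilde h:\beta X\to Y$ is the unique continuous extension of $h$. For $f:X^n\to X$, $\tilde f(\mathfrak u_1,\dots,\mathfrak u_n)=\{A:(\forall^{\mathfrak u_1}x_1)\cdots(\forall^{\mathfrak u_n}x_n)f(x_1,\dots,x_n)\in A\}$; for $Q\subseteq X^n$, $\tilde Q=\{(\mathfrak u_i):(\forall^{\mathfrak u_1}x_1)\cdots(\forall^{\mathfrak u_n}x_n)(x_1,\dots,x_n)\in Q\}$, $Q^*=\{(\mathfrak u_i):\forall A_i\in\mathfrak u_i\ Q\cap(A_1\times\dots\times A_n)\ne\emptyset\}$; for an ordinary model $\mathfrak A=(X,F,\dots,R,\dots)$, $\widetilde{\mathfrak A}=(\beta X,\tilde F,\dots,\tilde R,\dots)$, $\mathfrak A^*=(\beta X,\tilde F,\dots,R^*,\dots)$. Narrow sense: interpretation $\imath$ with $\imath(F)\in\beta(X^{X^n})$, $\imath(R)\in\beta\,\mathcal P(X^n)$; pseudo-principal on functional symbols: for all $F$ and $a_1,\dots,a_n\in X$, $\{A:(\forall^{\imath(F)}f)f(a_1,\dots,a_n)\in A\}$ is principal. $\mathrm{RC}_n$: maps $(\beta X)^n\to\beta X$ right continuous w.r.t. $X$ (continuous in the $i$-th argument whenever the first $i-1$ arguments lie in $X$), topology of pointwise convergence on $X^n$. $e$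 on $\beta(X^{X^n})$: unique continuous extension of $f\mapsto\tilde f$ into $\mathrm{RC}_n$; $e$ on $\beta\,\mathcal P(X^n)$: unique continuous extension of $Q\mapsto\tilde Q$ (characteristic functions into discrete $\{0,1\}$, pointwise convergence on $X^n$); $e(\mathfrak B)$ is the ordinary model on $\beta X$ with these values; when $\mathfrak B$ is pseudo-principal, $X$ is closed under the operations of $e(\mathfrak B)$ and the principal submodel is the submodel of $e(\mathfrak B)$ on $X$. $\mathrm{RegCl}_n=\{Q^*:Q\subseteq X^n\}$ (regular closed subsets of $(\beta X)^n$) with the topology transported from $\{0,1\}^{X^n}\cong\mathcal P(X^n)$ via $Q\mapsto Q^*$. $I(\mathfrak f)=\{B:\{f:\tilde f\in B\}\in\mathfrak f\}$ for $\mathfrak f\in\beta(X^{X^n})$, $I(\mathfrak r)=\{B\subseteq\mathcal P((\beta X)^n):\{Q:Q^*\in B\}\in\mathfrak r\}$ for $\mathfrak r\in\beta\,\mathcal P(X^n)$; $\mathfrak U=I(\mathfrak B)$ is the wide-sense model with universe $\beta X$ interpreting each symbol by $I$ of its $\mathfrak B$-interpretation, limits taken in $\mathrm{RC}_n$ and $\mathrm{RegCl}_n$. Wide sense: symbols interpreted by ultrafilters on $W^{W^n}$, $\mathcal P(W^n)$; a limit is the unique point of convergence; $\lim$ of the model interprets each symbol by its limit. For topological $Z$ and $A\subseteq Z$, $RC_A(Z^n,Z)$ are the maps continuous in the $i$-th argument whenever the first $i-1$ arguments lie in $A$. Homomorphisms involving wide-sense models are homomorphisms of the corresponding limit models; ordinary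 models are identified with wide-sense models having the principal interpretation (whose limit is the model itself). *)

theory Defs
  imports "HOL-Analysis.Analysis"
begin

section \<open>Ultrafilters on a set\<close>

definition ultrafilter_on :: "'a set \<Rightarrow> 'a set set \<Rightarrow> bool" where
  "ultrafilter_on X u \<longleftrightarrow>
     u \<subseteq> Pow X \<and> X \<in> u \<and> {} \<notin> u \<and>
     (\<forall>A\<in>u. \<forall>B\<in>u. A \<inter> B \<in> u) \<and>
     (\<forall>A\<in>u. \<forall>B. A \<subseteq> B \<and> B \<subseteq> X \<longrightarrow> B \<in> u) \<and>
     (\<forall>A. A \<subseteq> X \<longrightarrow> A \<in> u \<or> X - A \<in> u)"

definition ultrafilters :: "'a set \<Rightarrow> 'a set set set" where
  "ultrafilters X = {u. ultrafilter_on X u}"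

definition ultrafilter_topology :: "'a set \<Rightarrow> 'a set set topology" where
  "ultrafilter_topology X =
     topology_generated_by ((\<lambda>A. {u \<in> ultrafilters X. A \<in> u}) ` Pow X)"

definition principal_on :: "'a set \<Rightarrow> 'a \<Rightarrow> 'a set set" where
  "principal_on X x = {A. A \<subseteq> X \<and> x \<in> A}"

text \<open>
  The unique continuous extension of \<open>h\<close> to the space of ultrafilters on \<open>X\<close>, as a map into
  the space \<open>T\<close>. Extensionality only fixes the junk value outside the space of ultrafilters.
\<close>

definition continuous_extension :: "'a set \<Rightarrow> 'b topology \<Rightarrow> ('a \<Rightarrow> 'b) \<Rightarrow> 'a set set \<Rightarrow> 'b" where
  "continuous_extension X T h =
     (THE g. g \<in> extensional (ultrafilters X) \<and>
             continuous_map (ultrafilter_topology X) T g \<and>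
             (\<forall>x\<in>X. g (principal_on X x) = h x))"


section \<open>Tuples, operations and right continuity\<close>

text \<open>
  An \<open>n\<close>-tuple over \<open>X\<close> is an extensional function on \<open>{..<n}\<close>, so that the \<open>n\<close>-th power of a
  space \<open>T\<close> is \<open>product_topology (\<lambda>_. T) {..<n}\<close>; components are numbered from \<open>0\<close>.
\<close>

abbreviation tuples :: "'a set \<Rightarrow> nat \<Rightarrow> (nat \<Rightarrow> 'a) set" where
  "tuples X n \<equiv> {..<n} \<rightarrow>\<^sub>E X"

abbreviation operations :: "'a set \<Rightarrow> nat \<Rightarrow> ((nat \<Rightarrow> 'a) \<Rightarrow> 'a) set" where
  "operations X n \<equiv> tuples X n \<rightarrow>\<^sub>E X"

abbreviation relations :: "'a set \<Rightarrow> nat \<Rightarrow> (nat \<Rightarrow> 'a) set set" where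
  "relations X n \<equiv> Pow (tuples X n)"

definition map_tuple :: "nat \<Rightarrow> ('a \<Rightarrow> 'b) \<Rightarrow> (nat \<Rightarrow> 'a) \<Rightarrow> nat \<Rightarrow> 'b" where
  "map_tuple n g x = (\<lambda>i\<in>{..<n}. g (x i))"

definition right_continuous ::
    "'a topology \<Rightarrow> 'a set \<Rightarrow> nat \<Rightarrow> 'b topology \<Rightarrow> ((nat \<Rightarrow> 'a) \<Rightarrow> 'b) set" where
  "right_continuous T A n T' =
     {f \<in> tuples (topspace T) n \<rightarrow>\<^sub>E topspace T'.
        \<forall>i<n. \<forall>a \<in> tuples (topspace T) n.
          (\<forall>j<i. a j \<in> A) \<longrightarrow> continuous_map T T' (\<lambda>z. f (a(i := z)))}"


section \<open>Extensions of operations and relations\<close>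

text \<open>
  The iterated quantifier binding \<open>x 0, \<dots>, x (n - 1)\<close> by \<open>u 0, \<dots>, u (n - 1)\<close>, where
  the quantifier for \<open>x 0\<close> is the outermost one.
\<close>

primrec ultra_all ::
    "'a set \<Rightarrow> (nat \<Rightarrow> 'a set set) \<Rightarrow> nat \<Rightarrow> ((nat \<Rightarrow> 'a) \<Rightarrow> bool) \<Rightarrow> bool" where
  "ultra_all X u 0 \<phi> = \<phi> (\<lambda>_. undefined)"
| "ultra_all X u (Suc n) \<phi> = ultra_all X u n (\<lambda>x. {y \<in> X. \<phi> (x(n := y))} \<in> u n)"

definition fun_tilde ::
    "'a set \<Rightarrow> nat \<Rightarrow> ((nat \<Rightarrow> 'a) \<Rightarrow> 'a) \<Rightarrow> (nat \<Rightarrow> 'a set set) \<Rightarrow> 'a set set" where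
  "fun_tilde X n f =
     (\<lambda>u \<in> tuples (ultrafilters X) n. {A. A \<subseteq> X \<and> ultra_all X u n (\<lambda>x. f x \<in> A)})"

definition rel_tilde :: "'a set \<Rightarrow> nat \<Rightarrow> (nat \<Rightarrow> 'a) set \<Rightarrow> (nat \<Rightarrow> 'a set set) set" where
  "rel_tilde X n Q = {u \<in> tuples (ultrafilters X) n. ultra_all X u n (\<lambda>x. x \<in> Q)}"

definition rel_star :: "'a set \<Rightarrow> nat \<Rightarrow> (nat \<Rightarrow> 'a) set \<Rightarrow> (nat \<Rightarrow> 'a set set) set" where
  "rel_star X n Q =
     {u \<in> tuples (ultrafilters X) n. \<forall>A. (\<forall>i<n. A i \<in> u i) \<longrightarrow> Q \<inter> (\<Pi>\<^sub>E i\<in>{..<n}. A i) \<noteq> {}}"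

abbreviation principal_tuples :: "'a set \<Rightarrow> nat \<Rightarrow> (nat \<Rightarrow> 'a set set) set" where
  "principal_tuples X n \<equiv> tuples (principal_on X ` X) n"

definition RC :: "'a set \<Rightarrow> nat \<Rightarrow> ((nat \<Rightarrow> 'a set set) \<Rightarrow> 'a set set) set" where
  "RC X n =
     right_continuous (ultrafilter_topology X) (principal_on X ` X) n (ultrafilter_topology X)"

definition RC_topology :: "'a set \<Rightarrow> nat \<Rightarrow> ((nat \<Rightarrow> 'a set set) \<Rightarrow> 'a set set) topology" where
  "RC_topology X n =
     pullback_topology (RC X n) (\<lambda>f. restrict f (principal_tuples X n))
       (product_topology (\<lambda>_. ultrafilter_topology X) (principal_tuples X n))"

text \<open>
  Relations whose characteristic functions, with \<^typ>\<open>bool\<close> as the discrete two-point space,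
  are right continuous. Right continuity makes the topology of pointwise convergence on principal
  tuples Hausdorff, so the extension of \<^const>\<open>rel_tilde\<close> is unique.
\<close>

definition RC_rel :: "'a set \<Rightarrow> nat \<Rightarrow> (nat \<Rightarrow> 'a set set) set set" where
  "RC_rel X n =
     {S. S \<subseteq> tuples (ultrafilters X) n \<and>
         (\<lambda>u \<in> tuples (ultrafilters X) n. u \<in> S) \<in>
           right_continuous (ultrafilter_topology X) (principal_on X ` X) n (discrete_topology UNIV)}"

definition RC_rel_topology :: "'a set \<Rightarrow> nat \<Rightarrow> (nat \<Rightarrow> 'a set set) set topology" where
  "RC_rel_topology X n =
     pullback_topology (RC_rel X n) (\<lambda>S. \<lambda>u \<in> principal_tuples X n. u \<in> S)
       (product_topology (\<lambda>_. discrete_topology UNIV) (principal_tuples X n))"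

definition e_fun ::
    "'a set \<Rightarrow> nat \<Rightarrow> ((nat \<Rightarrow> 'a) \<Rightarrow> 'a) set set \<Rightarrow> (nat \<Rightarrow> 'a set set) \<Rightarrow> 'a set set" where
  "e_fun X n = continuous_extension (operations X n) (RC_topology X n) (fun_tilde X n)"

definition e_rel ::
    "'a set \<Rightarrow> nat \<Rightarrow> (nat \<Rightarrow> 'a) set set set \<Rightarrow> (nat \<Rightarrow> 'a set set) set" where
  "e_rel X n = continuous_extension (relations X n) (RC_rel_topology X n) (rel_tilde X n)"

definition RegCl :: "'a set \<Rightarrow> nat \<Rightarrow> (nat \<Rightarrow> 'a set set) set set" where
  "RegCl X n = rel_star X n ` relations X n"

definition relations_topology :: "'a set \<Rightarrow> nat \<Rightarrow> (nat \<Rightarrow> 'a) set topology" where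
  "relations_topology X n =
     pullback_topology (relations X n) (\<lambda>Q. \<lambda>x \<in> tuples X n. x \<in> Q)
       (product_topology (\<lambda>_. discrete_topology (UNIV :: bool set)) (tuples X n))"

text \<open>
  The map \<^const>\<open>rel_star\<close> is injective on relations; the topology is transported along it,
  i.e. pulled back along its inverse.
\<close>

definition RegCl_topology :: "'a set \<Rightarrow> nat \<Rightarrow> (nat \<Rightarrow> 'a set set) set topology" where
  "RegCl_topology X n =
     pullback_topology (RegCl X n) (inv_into (relations X n) (rel_star X n)) (relations_topology X n)"

definition I_fun ::
    "'a set \<Rightarrow> nat \<Rightarrow> ((nat \<Rightarrow> 'a) \<Rightarrow> 'a) set set \<Rightarrow> ((nat \<Rightarrow> 'a set set) \<Rightarrow> 'a set set) set set" where
  "I_fun X n \<ff> =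
     {B. B \<subseteq> operations (ultrafilters X) n \<and> {f \<in> operations X n. fun_tilde X n f \<in> B} \<in> \<ff>}"

definition I_rel ::
    "'a set \<Rightarrow> nat \<Rightarrow> (nat \<Rightarrow> 'a) set set set \<Rightarrow> (nat \<Rightarrow> 'a set set) set set set" where
  "I_rel X n \<rr> =
     {B. B \<subseteq> relations (ultrafilters X) n \<and> {Q \<in> relations X n. rel_star X n Q \<in> B} \<in> \<rr>}"


section \<open>Limits of ultrafilters\<close>

text \<open>
  The space \<open>T\<close> may be smaller than the set carrying the ultrafilter; since \<open>topspace T\<close> is
  itself a neighbourhood, convergence then forces it to belong to the ultrafilter.
\<close>

definition ultra_converges :: "'b topology \<Rightarrow> 'b set set \<Rightarrow> 'b \<Rightarrow> bool" where
  "ultra_converges T u z \<longleftrightarrow> z \<in> topspace T \<and> (\<forall>U. openin T U \<and> z \<in> U \<longrightarrow> U \<in> u)"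

definition has_ultra_limit :: "'b topology \<Rightarrow> 'b set set \<Rightarrow> bool" where
  "has_ultra_limit T u \<longleftrightarrow> (\<exists>!z. ultra_converges T u z)"

definition ultra_limit :: "'b topology \<Rightarrow> 'b set set \<Rightarrow> 'b" where
  "ultra_limit T u = (THE z. ultra_converges T u z)"


section \<open>Models\<close>

record ('f, 'p) signature =
  fun_symbols :: "'f set"
  pred_symbols :: "'p set"
  fun_arity :: "'f \<Rightarrow> nat"
  pred_arity :: "'p \<Rightarrow> nat"

record ('a, 'f, 'p) model =
  universe :: "'a set"
  fun_int :: "'f \<Rightarrow> (nat \<Rightarrow> 'a) \<Rightarrow> 'a"
  pred_int :: "'p \<Rightarrow> (nat \<Rightarrow> 'a) set"

text \<open>
  A generalized model in the narrow sense is given by its base set \<open>X\<close>; its universe is the set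
  of ultrafilters on \<open>X\<close>.
\<close>

record ('a, 'f, 'p) narrow_model =
  base :: "'a set"
  narrow_fun :: "'f \<Rightarrow> ((nat \<Rightarrow> 'a) \<Rightarrow> 'a) set set"
  narrow_pred :: "'p \<Rightarrow> (nat \<Rightarrow> 'a) set set set"

record ('a, 'f, 'p) wide_model =
  wide_universe :: "'a set"
  wide_fun :: "'f \<Rightarrow> ((nat \<Rightarrow> 'a) \<Rightarrow> 'a) set set"
  wide_pred :: "'p \<Rightarrow> (nat \<Rightarrow> 'a) set set set"

definition is_narrow_model :: "('f, 'p) signature \<Rightarrow> ('a, 'f, 'p) narrow_model \<Rightarrow> bool" where
  "is_narrow_model \<Sigma> \<BB> \<longleftrightarrow>
     (\<forall>F \<in> fun_symbols \<Sigma>. narrow_fun \<BB> F \<in> ultrafilters (operations (base \<BB>) (fun_arity \<Sigma> F))) \<and>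
     (\<forall>R \<in> pred_symbols \<Sigma>. narrow_pred \<BB> R \<in> ultrafilters (relations (base \<BB>) (pred_arity \<Sigma> R)))"

definition is_wide_model :: "('f, 'p) signature \<Rightarrow> ('a, 'f, 'p) wide_model \<Rightarrow> bool" where
  "is_wide_model \<Sigma> \<VV> \<longleftrightarrow>
     (\<forall>F \<in> fun_symbols \<Sigma>.
        wide_fun \<VV> F \<in> ultrafilters (operations (wide_universe \<VV>) (fun_arity \<Sigma> F))) \<and>
     (\<forall>R \<in> pred_symbols \<Sigma>.
        wide_pred \<VV> R \<in> ultrafilters (relations (wide_universe \<VV>) (pred_arity \<Sigma> R)))"

definition pseudo_principal_on_funs ::
    "('f, 'p) signature \<Rightarrow> ('a, 'f, 'p) narrow_model \<Rightarrow> bool" where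
  "pseudo_principal_on_funs \<Sigma> \<BB> \<longleftrightarrow>
     (\<forall>F \<in> fun_symbols \<Sigma>. \<forall>a \<in> tuples (base \<BB>) (fun_arity \<Sigma> F). \<exists>b \<in> base \<BB>.
        {A. A \<subseteq> base \<BB> \<and> {f \<in> operations (base \<BB>) (fun_arity \<Sigma> F). f a \<in> A} \<in> narrow_fun \<BB> F}
          = principal_on (base \<BB>) b)"

definition e_model ::
    "('f, 'p) signature \<Rightarrow> ('a, 'f, 'p) narrow_model \<Rightarrow> ('a set set, 'f, 'p) model" where
  "e_model \<Sigma> \<BB> =
     \<lparr>universe = ultrafilters (base \<BB>),
      fun_int = (\<lambda>F. e_fun (base \<BB>) (fun_arity \<Sigma> F) (narrow_fun \<BB> F)),
      pred_int = (\<lambda>R. e_rel (base \<BB>) (pred_arity \<Sigma> R) (narrow_pred \<BB> R))\<rparr>"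

text \<open>
  The submodel of \<open>e_model \<Sigma> \<BB>\<close> on the principal ultrafilters, carried over to the base
  set along \<open>principal_on (base \<BB>)\<close>. The values \<open>inv_into\<close> are meaningful because the principal
  ultrafilters are closed under the operations whenever \<open>\<BB>\<close> is pseudo-principal on functional
  symbols.
\<close>

definition principal_submodel ::
    "('f, 'p) signature \<Rightarrow> ('a, 'f, 'p) narrow_model \<Rightarrow> ('a, 'f, 'p) model" where
  "principal_submodel \<Sigma> \<BB> =
     (let X = base \<BB> in
      \<lparr>universe = X,
       fun_int = (\<lambda>F. \<lambda>x \<in> tuples X (fun_arity \<Sigma> F).
         inv_into X (principal_on X)
           (fun_int (e_model \<Sigma> \<BB>) F (map_tuple (fun_arity \<Sigma> F) (principal_on X) x))),
       pred_int = (\<lambda>R. {x \<in> tuples X (pred_arity \<Sigma> R).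
         map_tuple (pred_arity \<Sigma> R) (principal_on X) x \<in> pred_int (e_model \<Sigma> \<BB>) R})\<rparr>)"

definition tilde_model ::
    "('f, 'p) signature \<Rightarrow> ('a, 'f, 'p) model \<Rightarrow> ('a set set, 'f, 'p) model" where
  "tilde_model \<Sigma> \<AA> =
     \<lparr>universe = ultrafilters (universe \<AA>),
      fun_int = (\<lambda>F. fun_tilde (universe \<AA>) (fun_arity \<Sigma> F) (fun_int \<AA> F)),
      pred_int = (\<lambda>R. rel_tilde (universe \<AA>) (pred_arity \<Sigma> R) (pred_int \<AA> R))\<rparr>"

definition star_model ::
    "('f, 'p) signature \<Rightarrow> ('a, 'f, 'p) model \<Rightarrow> ('a set set, 'f, 'p) model" where
  "star_model \<Sigma> \<AA> =
     \<lparr>universe = ultrafilters (universe \<AA>),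
      fun_int = (\<lambda>F. fun_tilde (universe \<AA>) (fun_arity \<Sigma> F) (fun_int \<AA> F)),
      pred_int = (\<lambda>R. rel_star (universe \<AA>) (pred_arity \<Sigma> R) (pred_int \<AA> R))\<rparr>"

definition I_model ::
    "('f, 'p) signature \<Rightarrow> ('a, 'f, 'p) narrow_model \<Rightarrow> ('a set set, 'f, 'p) wide_model" where
  "I_model \<Sigma> \<BB> =
     \<lparr>wide_universe = ultrafilters (base \<BB>),
      wide_fun = (\<lambda>F. I_fun (base \<BB>) (fun_arity \<Sigma> F) (narrow_fun \<BB> F)),
      wide_pred = (\<lambda>R. I_rel (base \<BB>) (pred_arity \<Sigma> R) (narrow_pred \<BB> R))\<rparr>"

definition limit_model ::
    "('f, 'p) signature \<Rightarrow> (nat \<Rightarrow> ((nat \<Rightarrow> 'a) \<Rightarrow> 'a) topology) \<Rightarrow> (nat \<Rightarrow> (nat \<Rightarrow> 'a) set topology) \<Rightarrow>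
     ('a, 'f, 'p) wide_model \<Rightarrow> ('a, 'f, 'p) model" where
  "limit_model \<Sigma> TF TP \<VV> =
     \<lparr>universe = wide_universe \<VV>,
      fun_int = (\<lambda>F. ultra_limit (TF (fun_arity \<Sigma> F)) (wide_fun \<VV> F)),
      pred_int = (\<lambda>R. ultra_limit (TP (pred_arity \<Sigma> R)) (wide_pred \<VV> R))\<rparr>"

definition homomorphism ::
    "('f, 'p) signature \<Rightarrow> ('a, 'f, 'p) model \<Rightarrow> ('b, 'f, 'p) model \<Rightarrow> ('a \<Rightarrow> 'b) \<Rightarrow> bool" where
  "homomorphism \<Sigma> \<AA> \<CC> h \<longleftrightarrow>
     h \<in> universe \<AA> \<rightarrow> universe \<CC> \<and>
     (\<forall>F \<in> fun_symbols \<Sigma>. \<forall>x \<in> tuples (universe \<AA>) (fun_arity \<Sigma> F).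
        h (fun_int \<AA> F x) = fun_int \<CC> F (map_tuple (fun_arity \<Sigma> F) h x)) \<and>
     (\<forall>R \<in> pred_symbols \<Sigma>. \<forall>x \<in> tuples (universe \<AA>) (pred_arity \<Sigma> R).
        x \<in> pred_int \<AA> R \<longrightarrow> map_tuple (pred_arity \<Sigma> R) h x \<in> pred_int \<CC> R)"

end

theory Submission
  imports Defs
begin

text \<open>
  Write \<open>g\<close> and \<open>Q\<close> for the operations and relations of the principal submodel.
  The extension of an ultrafilter on operations is the right continuous extension of its pointwise
  evaluations, and a right continuous map is determined by its values on principal tuples, since
  one argument at a time can be moved off the dense set of principal ultrafilters. Hence
  pseudo-principality makes the limit of the wide-sense interpretation equal to the right
  continuous extension of \<open>g\<close>; for relations, \<open>Q\<close> is recovered from its regular closed extension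
  by restriction to principal tuples, so that the limit is the regular closed extension of \<open>Q\<close>.
  Thus the limit of \<open>\<UU>\<close> is the model \<open>\<AA>\<^sup>*\<close>.

  A homomorphism \<open>h\<close> of \<open>\<AA>\<close> lifts to \<open>\<AA>\<^sup>*\<close>: both sides of the equation for an operation
  are right continuous and agree on principal tuples, and the preimage of a basic open box around a
  point outside the closed target relation would contain a tuple of \<open>Q\<close>. A homomorphism of
  \<open>\<AA>\<^sup>*\<close> is one of the tilde model because the tilde extension of \<open>Q\<close> is the smaller one, and
  restriction to principal tuples leads back to \<open>\<AA>\<close>.
\<close>

section \<open>Ultrafilters\<close>

lemma ultrafiltersI:
  assumes "u \<subseteq> Pow X" "X \<in> u" "{} \<notin> u"
    and "\<And>A B. A \<in> u \<Longrightarrow> B \<in> u \<Longrightarrow> A \<inter> B \<in> u"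
    and "\<And>A B. A \<in> u \<Longrightarrow> A \<subseteq> B \<Longrightarrow> B \<subseteq> X \<Longrightarrow> B \<in> u"
    and "\<And>A. A \<subseteq> X \<Longrightarrow> A \<in> u \<or> X - A \<in> u"
  shows "u \<in> ultrafilters X"
  using assms unfolding ultrafilters_def ultrafilter_on_def by blast

lemma
  assumes "u \<in> ultrafilters X"
  shows ultrafilter_subset: "A \<in> u \<Longrightarrow> A \<subseteq> X"
    and ultrafilter_top: "X \<in> u"
    and ultrafilter_empty: "{} \<notin> u"
    and ultrafilter_Int: "A \<in> u \<Longrightarrow> B \<in> u \<Longrightarrow> A \<inter> B \<in> u"
    and ultrafilter_mono: "A \<in> u \<Longrightarrow> A \<subseteq> B \<Longrightarrow> B \<subseteq> X \<Longrightarrow> B \<in> u"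
    and ultrafilter_cases: "A \<subseteq> X \<Longrightarrow> A \<in> u \<or> X - A \<in> u"
  using assms unfolding ultrafilters_def ultrafilter_on_def by blast+

lemma ultrafilter_Diff_iff:
  assumes "u \<in> ultrafilters X" "A \<subseteq> X"
  shows "X - A \<in> u \<longleftrightarrow> A \<notin> u"
proof
  assume "X - A \<in> u"
  then show "A \<notin> u"
    using ultrafilter_Int[OF assms(1), of A "X - A"] ultrafilter_empty[OF assms(1)] by auto
qed (use ultrafilter_cases[OF assms] in blast)

lemma ultrafilter_Int_iff:
  assumes "u \<in> ultrafilters X" "A \<subseteq> X" "B \<subseteq> X"
  shows "A \<inter> B \<in> u \<longleftrightarrow> A \<in> u \<and> B \<in> u"
  using ultrafilter_Int[OF assms(1)] ultrafilter_mono[OF assms(1), of "A \<inter> B"] assms by blast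

text \<open>Finite index sets arise below as finite subcovers and as the finitely many coordinates
  restricted by a basic open set of a product.\<close>

lemma ultrafilter_Collect_ball:
  assumes u: "u \<in> ultrafilters X" and "finite I" "\<And>i. i \<in> I \<Longrightarrow> {x \<in> X. P i x} \<in> u"
  shows "{x \<in> X. \<forall>i\<in>I. P i x} \<in> u"
  using assms(2,3)
proof (induction I)
  case empty
  then show ?case using ultrafilter_top[OF u] by simp
next
  case (insert i I)
  then have "{x \<in> X. P i x} \<inter> {x \<in> X. \<forall>i\<in>I. P i x} \<in> u"
    by (intro ultrafilter_Int[OF u]) auto
  moreover have "{x \<in> X. P i x} \<inter> {x \<in> X. \<forall>i\<in>I. P i x} = {x \<in> X. \<forall>i\<in>insert i I. P i x}"
    by auto
  ultimately show ?case by simp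
qed

text \<open>Ultrafilters are maximal: a member \<open>A\<close> of \<open>v\<close> missing from
  \<open>u\<close> would have its complement in \<open>u\<close>, hence in \<open>v\<close> together
  with \<open>A\<close>.\<close>

lemma ultrafilters_eqI:
  assumes "u \<in> ultrafilters X" "v \<in> ultrafilters X" "u \<subseteq> v"
  shows "u = v"
proof (intro equalityI subsetI)
  fix A assume "A \<in> v"
  then have "A \<subseteq> X" using ultrafilter_subset[OF assms(2)] by simp
  then show "A \<in> u"
    using \<open>A \<in> v\<close> assms ultrafilter_Diff_iff[of u X A] ultrafilter_Diff_iff[of v X A] by auto
qed (use assms in auto)

section \<open>Principal ultrafilters\<close>

lemma principal_on_iff: "A \<subseteq> X \<Longrightarrow> A \<in> principal_on X x \<longleftrightarrow> x \<in> A"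
  by (simp add: principal_on_def)

lemma principal_on_ultrafilter: "x \<in> X \<Longrightarrow> principal_on X x \<in> ultrafilters X"
  by (rule ultrafiltersI) (auto simp: principal_on_def)

lemma principal_on_funcset: "principal_on X \<in> X \<rightarrow> ultrafilters X"
  by (rule Pi_I) (rule principal_on_ultrafilter)

text \<open>The singleton \<open>{x}\<close> belongs to the principal ultrafilter at
  \<open>x\<close> and to none at another point. Injectivity is what gives \<open>inv_into\<close>
  in \<open>principal_submodel\<close> its meaning.\<close>

lemma inj_on_principal_on: "inj_on (principal_on X) X"
  by (rule inj_onI) (metis (no_types, lifting) empty_subsetI insert_subset principal_on_iff singletonD singletonI)

text \<open>The pushforward of an ultrafilter. \<open>I_fun\<close>, \<open>I_rel\<close> and the
  pointwise evaluation in the pseudo-principality condition are all of this form.\<close>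

definition image_ultrafilter :: "'a set \<Rightarrow> 'b set \<Rightarrow> ('a \<Rightarrow> 'b) \<Rightarrow> 'a set set \<Rightarrow> 'b set set" where
  "image_ultrafilter X Y f u = {A. A \<subseteq> Y \<and> {x \<in> X. f x \<in> A} \<in> u}"

lemma image_ultrafilter_iff: "A \<subseteq> Y \<Longrightarrow> A \<in> image_ultrafilter X Y f u \<longleftrightarrow> {x \<in> X. f x \<in> A} \<in> u"
  by (simp add: image_ultrafilter_def)

lemma image_ultrafilter_in_ultrafilters:
  assumes u: "u \<in> ultrafilters X" and f: "f \<in> X \<rightarrow> Y"
  shows "image_ultrafilter X Y f u \<in> ultrafilters Y"
proof (rule ultrafiltersI)
  have "{x \<in> X. f x \<in> Y} = X" using f by auto
  then show "Y \<in> image_ultrafilter X Y f u"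
    using ultrafilter_top[OF u] by (simp add: image_ultrafilter_def)
next
  fix A B assume *: "A \<in> image_ultrafilter X Y f u" "B \<in> image_ultrafilter X Y f u"
  have "{x \<in> X. f x \<in> A \<inter> B} = {x \<in> X. f x \<in> A} \<inter> {x \<in> X. f x \<in> B}" by auto
  then show "A \<inter> B \<in> image_ultrafilter X Y f u"
    using * ultrafilter_Int[OF u] by (auto simp: image_ultrafilter_def)
next
  fix A B assume "A \<in> image_ultrafilter X Y f u" "A \<subseteq> B" "B \<subseteq> Y"
  then show "B \<in> image_ultrafilter X Y f u"
    using ultrafilter_mono[OF u, of "{x \<in> X. f x \<in> A}" "{x \<in> X. f x \<in> B}"]
    by (auto simp: image_ultrafilter_def)
next
  fix A assume "A \<subseteq> Y"
  moreover have "{x \<in> X. f x \<in> Y - A} = X - {x \<in> X. f x \<in> A}" using f by auto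
  ultimately show "A \<in> image_ultrafilter X Y f u \<or> Y - A \<in> image_ultrafilter X Y f u"
    using ultrafilter_cases[OF u, of "{x \<in> X. f x \<in> A}"] by (auto simp: image_ultrafilter_def)
qed (use ultrafilter_empty[OF u] in \<open>auto simp: image_ultrafilter_def\<close>)

lemma image_ultrafilter_principal_on:
  assumes "f \<in> X \<rightarrow> Y" "x \<in> X"
  shows "image_ultrafilter X Y f (principal_on X x) = principal_on Y (f x)"
  using assms by (auto simp: image_ultrafilter_def principal_on_def)


section \<open>The space of ultrafilters\<close>

lemma topspace_ultrafilter_topology [simp]: "topspace (ultrafilter_topology X) = ultrafilters X"
  unfolding ultrafilter_topology_def topology_generated_by_topspace
  using ultrafilter_top by auto

lemma openin_ultrafilter_basic: "A \<subseteq> X \<Longrightarrow> openin (ultrafilter_topology X) {u \<in> ultrafilters X. A \<in> u}"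
  unfolding ultrafilter_topology_def by (rule topology_generated_by_Basis) auto

text \<open>The generating sets already form a base: an intersection of two of them is again one,
  since an ultrafilter contains \<open>A \<inter> B\<close> exactly if it contains both
  sets.\<close>

lemma ultrafilter_topology_base:
  assumes "openin (ultrafilter_topology X) U" "u \<in> U"
  obtains A where "A \<in> u" "{v \<in> ultrafilters X. A \<in> v} \<subseteq> U"
proof -
  have "u \<in> ultrafilters X" using assms openin_subset by fastforce
  have "generate_topology_on ((\<lambda>A. {u \<in> ultrafilters X. A \<in> u}) ` Pow X) U"
    using assms(1) openin_topology_generated_by unfolding ultrafilter_topology_def by blast
  then have "u \<in> U \<longrightarrow> (\<exists>A\<in>u. {v \<in> ultrafilters X. A \<in> v} \<subseteq> U)"
  proof induction
    case (Int U V)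
    show ?case
    proof
      assume "u \<in> U \<inter> V"
      then obtain A B where AB: "A \<in> u" "{v \<in> ultrafilters X. A \<in> v} \<subseteq> U"
          "B \<in> u" "{v \<in> ultrafilters X. B \<in> v} \<subseteq> V"
        using Int by auto
      have sub: "A \<subseteq> X" "B \<subseteq> X"
        using AB ultrafilter_subset[OF \<open>u \<in> ultrafilters X\<close>] by metis+
      have "{v \<in> ultrafilters X. A \<inter> B \<in> v} \<subseteq> U \<inter> V"
      proof
        fix v assume "v \<in> {v \<in> ultrafilters X. A \<inter> B \<in> v}"
        then have "v \<in> {v \<in> ultrafilters X. A \<in> v}" "v \<in> {v \<in> ultrafilters X. B \<in> v}"
          using sub by (auto simp: ultrafilter_Int_iff[of v X])
        then show "v \<in> U \<inter> V" using AB(2,4) by auto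
      qed
      moreover have "A \<inter> B \<in> u"
        using ultrafilter_Int[OF \<open>u \<in> ultrafilters X\<close> AB(1,3)] .
      ultimately show "\<exists>A\<in>u. {v \<in> ultrafilters X. A \<in> v} \<subseteq> U \<inter> V" by blast
    qed
  next
    case (UN K)
    then show ?case by blast
  qed auto
  then show thesis using that assms(2) by blast
qed

lemma continuous_map_into_ultrafilter_topology:
  assumes "f \<in> topspace T \<rightarrow> ultrafilters X"
    and "\<And>A. A \<subseteq> X \<Longrightarrow> openin T {x \<in> topspace T. A \<in> f x}"
  shows "continuous_map T (ultrafilter_topology X) f"
  unfolding ultrafilter_topology_def
proof (rule continuous_on_generated_topo)
  fix U assume "U \<in> (\<lambda>A. {u \<in> ultrafilters X. A \<in> u}) ` Pow X"
  then obtain A where A: "A \<subseteq> X" "U = {u \<in> ultrafilters X. A \<in> u}" by auto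
  then have "f -` U \<inter> topspace T = {x \<in> topspace T. A \<in> f x}" using assms(1) by auto
  then show "openin T (f -` U \<inter> topspace T)" using assms(2) A by simp
next
  show "f ` topspace T \<subseteq> \<Union> ((\<lambda>A. {u \<in> ultrafilters X. A \<in> u}) ` Pow X)"
    using assms(1) ultrafilter_top by fastforce
qed

text \<open>The sets of the base are clopen, because missing \<open>A\<close> means containing
  \<open>X - A\<close>. This yields continuity of the characteristic functions of extended
  relations.\<close>

lemma continuous_map_ultrafilter_to_bool:
  assumes "A \<subseteq> X"
  shows "continuous_map (ultrafilter_topology X) (discrete_topology UNIV) (\<lambda>u. A \<in> u)"
proof -
  have "openin (ultrafilter_topology X) {u \<in> ultrafilters X. (A \<in> u) \<in> V}" for V :: "bool set"
  proof -
    have mem_V: "(A \<in> u) \<in> V \<longleftrightarrow> A \<in> u \<and> True \<in> V \<or> A \<notin> u \<and> False \<in> V" for u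
      by (cases "A \<in> u") auto
    have eq: "{u \<in> ultrafilters X. (A \<in> u) \<in> V} =
        (if True \<in> V then {u \<in> ultrafilters X. A \<in> u} else {}) \<union>
        (if False \<in> V then {u \<in> ultrafilters X. X - A \<in> u} else {})"
      using assms mem_V by (auto simp: ultrafilter_Diff_iff)
    show ?thesis
      unfolding eq by (intro openin_Un) (auto intro!: openin_ultrafilter_basic assms)
  qed
  then show ?thesis by (simp add: continuous_map_def)
qed

text \<open>A set on which \<open>u\<close> and \<open>v\<close> disagree splits the space into two
  clopen halves that separate them.\<close>

lemma Hausdorff_ultrafilter_topology: "Hausdorff_space (ultrafilter_topology X)"
  unfolding Hausdorff_space_def
proof (intro allI impI, elim conjE)
  fix u v :: "'a set set"
  assume "u \<in> topspace (ultrafilter_topology X)" "v \<in> topspace (ultrafilter_topology X)" and "u \<noteq> v"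
  then have uv: "u \<in> ultrafilters X" "v \<in> ultrafilters X" by simp_all
  then obtain A where A: "A \<in> u" "A \<notin> v" using \<open>u \<noteq> v\<close> ultrafilters_eqI by blast
  then have AX: "A \<subseteq> X" using ultrafilter_subset uv by blast
  have "disjnt {w \<in> ultrafilters X. A \<in> w} {w \<in> ultrafilters X. X - A \<in> w}"
    using AX by (auto simp: disjnt_iff ultrafilter_Diff_iff)
  moreover have "X - A \<in> v" using A AX uv by (simp add: ultrafilter_Diff_iff)
  ultimately show "\<exists>U V. openin (ultrafilter_topology X) U \<and> openin (ultrafilter_topology X) V \<and>
      u \<in> U \<and> v \<in> V \<and> disjnt U V"
    using A uv AX
    by (intro exI[of _ "{w \<in> ultrafilters X. A \<in> w}"] exI[of _ "{w \<in> ultrafilters X. X - A \<in> w}"])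
      (simp add: openin_ultrafilter_basic)
qed

text \<open>Every \<open>A\<close> in \<open>u\<close> is nonempty, and each of its points gives a
  principal ultrafilter in the basic neighbourhood of \<open>A\<close>. This density underlies the
  uniqueness of extensions.\<close>

lemma closure_of_principal:
  assumes "u \<in> ultrafilters X"
  shows "u \<in> ultrafilter_topology X closure_of (principal_on X ` X)"
  unfolding in_closure_of
proof (intro conjI allI impI)
  fix U assume U: "u \<in> U \<and> openin (ultrafilter_topology X) U"
  then obtain A where A: "A \<in> u" "{v \<in> ultrafilters X. A \<in> v} \<subseteq> U"
    by (metis ultrafilter_topology_base)
  then have "A \<noteq> {}" using ultrafilter_empty[OF assms] by metis
  then obtain x where "x \<in> A" by blast
  moreover have "A \<subseteq> X" using A(1) ultrafilter_subset[OF assms] by blast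
  ultimately have "x \<in> X" "principal_on X x \<in> {v \<in> ultrafilters X. A \<in> v}"
    by (auto simp: principal_on_iff principal_on_ultrafilter subset_iff)
  then have "principal_on X x \<in> U" "x \<in> X" using A(2) by auto
  then show "\<exists>y. y \<in> principal_on X ` X \<and> y \<in> U" by blast
qed (use assms in simp)

lemma continuous_map_image_ultrafilter:
  assumes "f \<in> X \<rightarrow> Y"
  shows "continuous_map (ultrafilter_topology X) (ultrafilter_topology Y) (image_ultrafilter X Y f)"
  by (rule continuous_map_into_ultrafilter_topology)
    (auto simp: image_ultrafilter_iff image_ultrafilter_in_ultrafilters[OF _ assms]
      intro: openin_ultrafilter_basic)

text \<open>By density, any continuous \<open>g\<close> with the right values on principal
  ultrafilters is the map named by the definite description. Such a \<open>g\<close> is supplied by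
  an explicit formula for \<open>e_fun\<close> and \<open>e_rel\<close>, and by compactness for the
  extension of \<open>h\<close> into \<open>Y\<close>.\<close>

lemma continuous_extension_unique:
  assumes T: "Hausdorff_space T" and g: "continuous_map (ultrafilter_topology X) T g"
    and h: "\<And>x. x \<in> X \<Longrightarrow> g (principal_on X x) = h x"
  shows "continuous_extension X T h = restrict g (ultrafilters X)"
  unfolding continuous_extension_def
proof (rule the_equality)
  have "continuous_map (ultrafilter_topology X) T (restrict g (ultrafilters X))"
    using g by (rule continuous_map_eq) simp
  then show "restrict g (ultrafilters X) \<in> extensional (ultrafilters X) \<and>
      continuous_map (ultrafilter_topology X) T (restrict g (ultrafilters X)) \<and>
      (\<forall>x\<in>X. restrict g (ultrafilters X) (principal_on X x) = h x)"
    using h by (simp add: principal_on_ultrafilter)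
next
  fix g' assume g': "g' \<in> extensional (ultrafilters X) \<and>
    continuous_map (ultrafilter_topology X) T g' \<and> (\<forall>x\<in>X. g' (principal_on X x) = h x)"
  show "g' = restrict g (ultrafilters X)"
  proof (rule extensionalityI)
    fix u assume u: "u \<in> ultrafilters X"
    have "g' u = g u"
      by (rule forall_in_closure_of_eq[OF closure_of_principal[OF u] T _ g]) (use g' h in auto)
    then show "g' u = restrict g (ultrafilters X) u" using u by simp
  qed (use g' in auto)
qed

text \<open>Otherwise the open sets whose preimage is not in \<open>u\<close> cover the compact
  space. For a finite subcover the complements of the preimages lie in \<open>u\<close>, yet their
  intersection is empty.\<close>

lemma limit_along_ultrafilter_exists:
  assumes T: "compact_space T" and h: "h \<in> X \<rightarrow> topspace T" and u: "u \<in> ultrafilters X"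
  shows "\<exists>y\<in>topspace T. \<forall>U. openin T U \<and> y \<in> U \<longrightarrow> {x \<in> X. h x \<in> U} \<in> u"
proof (rule ccontr)
  assume neg: "\<not> ?thesis"
  define \<U> where "\<U> = {U. openin T U \<and> {x \<in> X. h x \<in> U} \<notin> u}"
  have "topspace T \<subseteq> \<Union>\<U>" using neg unfolding \<U>_def by blast
  then obtain \<F> where \<F>: "finite \<F>" "\<F> \<subseteq> \<U>" "topspace T \<subseteq> \<Union>\<F>"
    using T unfolding compact_space_alt \<U>_def by (metis (mono_tags, lifting) mem_Collect_eq)
  have "{x \<in> X. h x \<notin> U} \<in> u" if "U \<in> \<F>" for U
  proof -
    have "{x \<in> X. h x \<notin> U} = X - {x \<in> X. h x \<in> U}" by auto
    then show ?thesis using that \<F>(2) by (auto simp: ultrafilter_Diff_iff[OF u] \<U>_def)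
  qed
  then have "{x \<in> X. \<forall>U\<in>\<F>. h x \<notin> U} \<in> u"
    by (intro ultrafilter_Collect_ball[OF u \<F>(1)]) auto
  moreover have "h x \<in> \<Union>\<F>" if "x \<in> X" for x using \<F>(3) h that by auto
  then have "{x \<in> X. \<forall>U\<in>\<F>. h x \<notin> U} = {}" by auto
  ultimately show False using ultrafilter_empty[OF u] by simp
qed

text \<open>The universal property of the space of ultrafilters: the extension sends
  \<open>u\<close> to the limit of \<open>h\<close> along \<open>u\<close>. Continuity comes from
  regularity of a compact Hausdorff space; the value at a principal ultrafilter comes from Hausdorff
  separation.\<close>

lemma
  assumes T: "compact_space T" "Hausdorff_space T" and h: "h \<in> X \<rightarrow> topspace T"
  shows continuous_map_continuous_extension:
      "continuous_map (ultrafilter_topology X) T (continuous_extension X T h)"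
    and continuous_extension_principal_on:
      "\<And>x. x \<in> X \<Longrightarrow> continuous_extension X T h (principal_on X x) = h x"
proof -
  obtain g where g: "\<And>u. u \<in> ultrafilters X \<Longrightarrow> g u \<in> topspace T"
    "\<And>u U. u \<in> ultrafilters X \<Longrightarrow> openin T U \<Longrightarrow> g u \<in> U \<Longrightarrow> {x \<in> X. h x \<in> U} \<in> u"
    using limit_along_ultrafilter_exists[OF T(1) h] by metis
  have cont: "continuous_map (ultrafilter_topology X) T g"
    unfolding continuous_map_def topspace_ultrafilter_topology
  proof (intro conjI allI impI)
    fix U assume U: "openin T U"
    show "openin (ultrafilter_topology X) {u \<in> ultrafilters X. g u \<in> U}"
    proof (subst openin_subopen, intro ballI)
      fix u assume "u \<in> {u \<in> ultrafilters X. g u \<in> U}"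
      then have u: "u \<in> ultrafilters X" "g u \<in> U" by auto
      \<comment> \<open>Regularity separates \<open>g u\<close> from the complement of
        \<open>U\<close> by disjoint \<open>V\<close> and \<open>W\<close>. An ultrafilter
        containing the preimage of \<open>V\<close> cannot have its limit outside \<open>U\<close>,
        since it would then contain the disjoint preimage of \<open>W\<close> too.\<close>
      have "closedin T (topspace T - U)" "g u \<in> topspace T - (topspace T - U)"
        using U u g(1) by auto
      then obtain V W where VW: "openin T V" "openin T W" "g u \<in> V" "topspace T - U \<subseteq> W" "disjnt V W"
        using compact_Hausdorff_imp_regular_space[OF T] unfolding regular_space_def by metis
      let ?A = "{x \<in> X. h x \<in> V}"
      have "g v \<in> U" if v: "v \<in> ultrafilters X" "?A \<in> v" for v
      proof (rule ccontr)
        assume "g v \<notin> U"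
        then have "{x \<in> X. h x \<in> W} \<in> v" using VW g v by blast
        then have "?A \<inter> {x \<in> X. h x \<in> W} \<in> v" using v ultrafilter_Int by blast
        moreover have "?A \<inter> {x \<in> X. h x \<in> W} = {}" using VW(5) by (auto simp: disjnt_iff)
        ultimately show False using v ultrafilter_empty by auto
      qed
      moreover have "?A \<in> u" using g u VW by blast
      ultimately show "\<exists>T. openin (ultrafilter_topology X) T \<and> u \<in> T \<and> T \<subseteq> {u \<in> ultrafilters X. g u \<in> U}"
        using openin_ultrafilter_basic[of ?A X] u by (intro exI[of _ "{v \<in> ultrafilters X. ?A \<in> v}"]) auto
    qed
  qed (use g in auto)
  have principal: "g (principal_on X x) = h x" if "x \<in> X" for x
  proof (rule ccontr)
    assume neq: "g (principal_on X x) \<noteq> h x"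
    have "g (principal_on X x) \<in> topspace T" "h x \<in> topspace T"
      using g(1)[OF principal_on_ultrafilter[OF that]] h that by auto
    then obtain U V where UV: "openin T U" "openin T V" "g (principal_on X x) \<in> U" "h x \<in> V" "disjnt U V"
      using neq T(2) unfolding Hausdorff_space_def by metis
    then have "{x \<in> X. h x \<in> U} \<in> principal_on X x" 
      using g(2)[OF principal_on_ultrafilter[OF that] UV(1,3)] by simp
    then show False using UV by (auto simp: principal_on_def disjnt_iff)
  qed
  have eq: "continuous_extension X T h = restrict g (ultrafilters X)"
    using continuous_extension_unique[OF T(2) cont principal] .
  show "continuous_map (ultrafilter_topology X) T (continuous_extension X T h)"
    unfolding eq by (rule continuous_map_eq[OF cont]) simp
  show "continuous_extension X T h (principal_on X x) = h x" if "x \<in> X" for x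
    unfolding eq using that principal by (simp add: principal_on_ultrafilter)
qed


section \<open>Limits of image ultrafilters\<close>

text \<open>Two limits would have disjoint neighbourhoods, both in \<open>u\<close>. The set
  \<open>Z\<close> may be larger than \<open>topspace T\<close>, as for \<open>RC_topology\<close>,
  whose points are only some of the operations.\<close>

lemma ultra_limit_eqI:
  assumes T: "Hausdorff_space T" and u: "u \<in> ultrafilters Z" and z: "ultra_converges T u z"
  shows "ultra_limit T u = z"
  unfolding ultra_limit_def
proof (rule the_equality, rule z, rule ccontr)
  fix y assume y: "ultra_converges T u y" "y \<noteq> z"
  then obtain U V where UV: "openin T U" "openin T V" "y \<in> U" "z \<in> V" "disjnt U V"
    using T z unfolding Hausdorff_space_def ultra_converges_def by metis
  then have "U \<in> u" "V \<in> u" using y z unfolding ultra_converges_def by blast+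
  then have "U \<inter> V \<in> u" using ultrafilter_Int[OF u] by blast
  then show False using ultrafilter_empty[OF u] UV(5) by (simp add: disjnt_def)
qed

text \<open>A basic open set of a product restricts finitely many coordinates, so convergence can be
  tested one coordinate at a time. Both \<open>RC_topology\<close> and \<open>RegCl_topology\<close>
  are treated as pullbacks of products in this way.\<close>

lemma ultra_converges_pullback_product:
  assumes w: "w \<in> ultrafilters S" and \<phi>: "\<phi> \<in> S \<rightarrow> B" and B: "B \<subseteq> Z" and z: "z \<in> B"
    and q: "q \<in> B \<rightarrow> (\<Pi>\<^sub>E i\<in>I. topspace (T i))"
    and lim: "\<And>i V. i \<in> I \<Longrightarrow> openin (T i) V \<Longrightarrow> q z i \<in> V \<Longrightarrow> {s \<in> S. q (\<phi> s) i \<in> V} \<in> w"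
  shows "ultra_converges (pullback_topology B q (product_topology T I)) (image_ultrafilter S Z \<phi> w) z"
  unfolding ultra_converges_def
proof (intro conjI allI impI)
  show "z \<in> topspace (pullback_topology B q (product_topology T I))"
    using z q by (auto simp: topspace_pullback_topology)
  fix U assume "openin (pullback_topology B q (product_topology T I)) U \<and> z \<in> U"
  then obtain V where V: "openin (product_topology T I) V" "U = q -` V \<inter> B" and zU: "z \<in> U"
    unfolding openin_pullback_topology by blast
  obtain W where W: "finite {i \<in> I. W i \<noteq> topspace (T i)}" "\<And>i. i \<in> I \<Longrightarrow> openin (T i) (W i)"
      "q z \<in> Pi\<^sub>E I W" "Pi\<^sub>E I W \<subseteq> V"
    using V zU unfolding openin_product_topology_alt by auto
  \<comment> \<open>Coordinates outside \<open>?J\<close> impose no condition, because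
    \<open>q\<close> maps into the product of the whole spaces.\<close>
  let ?J = "{i \<in> I. W i \<noteq> topspace (T i)}"
  have "{s \<in> S. \<forall>i\<in>?J. q (\<phi> s) i \<in> W i} \<in> w"
    by (rule ultrafilter_Collect_ball[OF w W(1)]) (use lim W in auto)
  moreover have "{s \<in> S. \<forall>i\<in>?J. q (\<phi> s) i \<in> W i} \<subseteq> {s \<in> S. \<phi> s \<in> U}"
  proof clarify
    fix s assume s: "s \<in> S" "\<forall>i\<in>?J. q (\<phi> s) i \<in> W i"
    have "q (\<phi> s) \<in> (\<Pi>\<^sub>E i\<in>I. topspace (T i))" "\<phi> s \<in> B" using q \<phi> s by auto
    then have "q (\<phi> s) \<in> Pi\<^sub>E I W" using s by (auto simp: PiE_iff)
    then show "\<phi> s \<in> U" using W(4) V(2) \<open>\<phi> s \<in> B\<close> by auto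
  qed
  ultimately have "{s \<in> S. \<phi> s \<in> U} \<in> w"
    using ultrafilter_mono[OF w] by blast
  then show "U \<in> image_ultrafilter S Z \<phi> w"
    using V(2) B by (simp add: image_ultrafilter_def le_infI2)
qed

lemma Hausdorff_pullback_topology:
  assumes "Hausdorff_space T" "inj_on q B"
  shows "Hausdorff_space (pullback_topology B q T)"
proof (rule Hausdorff_space_injective_preimage[OF assms(1)])
  show "continuous_map (pullback_topology B q T) T q"
    using continuous_map_pullback[OF continuous_map_id, of B q T] by simp
  show "inj_on q (topspace (pullback_topology B q T))"
    using assms(2) by (rule inj_on_subset) (auto simp: topspace_pullback_topology)
qed


section \<open>Iterated ultrafilter quantifiers\<close>

lemma tuples_Suc_upd:
  assumes "x \<in> tuples X n" "y \<in> X"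
  shows "x(n := y) \<in> tuples X (Suc n)"
  using assms by (auto simp: PiE_iff extensional_def)

lemma tuples_upd: "a \<in> tuples X n \<Longrightarrow> i < n \<Longrightarrow> z \<in> X \<Longrightarrow> a(i := z) \<in> tuples X n"
  by (auto simp: PiE_iff extensional_def)

lemma map_tuple_in_tuples: "g \<in> X \<rightarrow> Y \<Longrightarrow> x \<in> tuples X n \<Longrightarrow> map_tuple n g x \<in> tuples Y n"
  by (auto simp: map_tuple_def PiE_iff)

lemma map_tuple_apply: "i < n \<Longrightarrow> map_tuple n g x i = g (x i)"
  by (simp add: map_tuple_def)

lemma map_tuple_cong: "(\<And>i. i < n \<Longrightarrow> g (x i) = h (y i)) \<Longrightarrow> map_tuple n g x = map_tuple n h y"
  by (auto simp: map_tuple_def)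

lemma map_tuple_upd: "i < n \<Longrightarrow> map_tuple n g (x(i := z)) = (map_tuple n g x)(i := g z)"
  by (auto simp: map_tuple_def fun_eq_iff)

lemma principal_tuplesE:
  assumes "p \<in> principal_tuples X n"
  obtains a where "a \<in> tuples X n" "p = map_tuple n (principal_on X) a"
proof -
  have "\<forall>i<n. \<exists>x\<in>X. p i = principal_on X x" using assms by (auto simp: PiE_iff)
  then obtain b where b: "\<And>i. i < n \<Longrightarrow> b i \<in> X \<and> p i = principal_on X (b i)" by metis
  then have "restrict b {..<n} \<in> tuples X n" by auto
  moreover have "p = map_tuple n (principal_on X) (restrict b {..<n})"
    using assms b by (auto simp: map_tuple_def PiE_iff extensional_def fun_eq_iff)
  ultimately show thesis using that by blast
qed

text \<open>The recursion evaluates the predicate only at extensional tuples: it starts at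
  \<open>\<lambda>_. undefined\<close>, the sole tuple of length \<open>0\<close>, and each step
  adds one component from \<open>X\<close>.\<close>

lemma ultra_all_cong:
  assumes "\<And>x. x \<in> tuples X n \<Longrightarrow> \<phi> x = \<psi> x"
  shows "ultra_all X u n \<phi> = ultra_all X u n \<psi>"
  using assms
proof (induction n arbitrary: \<phi> \<psi>)
  case (Suc n)
  have "ultra_all X u n (\<lambda>x. {y \<in> X. \<phi> (x(n := y))} \<in> u n) =
      ultra_all X u n (\<lambda>x. {y \<in> X. \<psi> (x(n := y))} \<in> u n)"
  proof (rule Suc.IH)
    fix x assume "x \<in> tuples X n"
    then have "{y \<in> X. \<phi> (x(n := y))} = {y \<in> X. \<psi> (x(n := y))}"
      by (intro Collect_cong conj_cong refl Suc.prems tuples_Suc_upd)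
    then show "({y \<in> X. \<phi> (x(n := y))} \<in> u n) = ({y \<in> X. \<psi> (x(n := y))} \<in> u n)" by simp
  qed
  then show ?case by simp
qed simp

text \<open>A single ultrafilter quantifier commutes with conjunction, and, as the next lemma shows,
  with negation; induction passes both to the iterated quantifier.\<close>

lemma ultra_all_conj:
  assumes "\<And>i. i < n \<Longrightarrow> u i \<in> ultrafilters X"
  shows "ultra_all X u n (\<lambda>x. \<phi> x \<and> \<psi> x) \<longleftrightarrow> ultra_all X u n \<phi> \<and> ultra_all X u n \<psi>"
  using assms
proof (induction n arbitrary: \<phi> \<psi>)
  case (Suc n)
  have "{y \<in> X. \<phi> (x(n := y)) \<and> \<psi> (x(n := y))} \<in> u n \<longleftrightarrow>
      {y \<in> X. \<phi> (x(n := y))} \<in> u n \<and> {y \<in> X. \<psi> (x(n := y))} \<in> u n" for x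
  proof -
    have "{y \<in> X. \<phi> (x(n := y)) \<and> \<psi> (x(n := y))} =
        {y \<in> X. \<phi> (x(n := y))} \<inter> {y \<in> X. \<psi> (x(n := y))}" by auto
    then show ?thesis using Suc.prems[of n] by (simp add: ultrafilter_Int_iff[of "u n" X])
  qed
  then show ?case using Suc.IH Suc.prems by simp
qed simp

lemma ultra_all_not:
  assumes "\<And>i. i < n \<Longrightarrow> u i \<in> ultrafilters X"
  shows "ultra_all X u n (\<lambda>x. \<not> \<phi> x) \<longleftrightarrow> \<not> ultra_all X u n \<phi>"
  using assms
proof (induction n arbitrary: \<phi>)
  case (Suc n)
  have "{y \<in> X. \<not> \<phi> (x(n := y))} \<in> u n \<longleftrightarrow> {y \<in> X. \<phi> (x(n := y))} \<notin> u n" for x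
  proof -
    have "{y \<in> X. \<not> \<phi> (x(n := y))} = X - {y \<in> X. \<phi> (x(n := y))}" by auto
    then show ?thesis using Suc.prems[of n] by (simp add: ultrafilter_Diff_iff[of "u n" X])
  qed
  then show ?case using Suc.IH Suc.prems by simp
qed simp

lemma ultra_all_mono:
  assumes "\<And>i. i < n \<Longrightarrow> u i \<in> ultrafilters X"
    and "\<And>x. x \<in> tuples X n \<Longrightarrow> \<phi> x \<Longrightarrow> \<psi> x" and "ultra_all X u n \<phi>"
  shows "ultra_all X u n \<psi>"
proof -
  have "ultra_all X u n \<phi> = ultra_all X u n (\<lambda>x. \<phi> x \<and> \<psi> x)"
    by (rule ultra_all_cong) (use assms(2) in blast)
  then show ?thesis using assms by (simp add: ultra_all_conj)
qed

text \<open>This is the bridge from iterated quantifiers, which define \<open>rel_tilde\<close>, to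
  boxes, which define \<open>rel_star\<close>.\<close>

lemma ultra_all_PiE:
  assumes "\<And>i. i < n \<Longrightarrow> u i \<in> ultrafilters X" "\<And>i. i < n \<Longrightarrow> A i \<in> u i"
  shows "ultra_all X u n (\<lambda>x. x \<in> (\<Pi>\<^sub>E i\<in>{..<n}. A i))"
  using assms
proof (induction n)
  case (Suc n)
  have "ultra_all X u n (\<lambda>x. {y \<in> X. x(n := y) \<in> (\<Pi>\<^sub>E i\<in>{..<Suc n}. A i)} \<in> u n)"
  proof (rule ultra_all_mono[of n u X "\<lambda>x. x \<in> (\<Pi>\<^sub>E i\<in>{..<n}. A i)"])
    fix x assume "x \<in> (\<Pi>\<^sub>E i\<in>{..<n}. A i)"
    then have "A n \<subseteq> {y. x(n := y) \<in> (\<Pi>\<^sub>E i\<in>{..<Suc n}. A i)}"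
      by (auto simp: PiE_iff extensional_def less_Suc_eq)
    moreover have n: "A n \<in> u n" "u n \<in> ultrafilters X" using Suc.prems by blast+
    moreover have "A n \<subseteq> X" using ultrafilter_subset[OF n(2,1)] .
    ultimately show "{y \<in> X. x(n := y) \<in> (\<Pi>\<^sub>E i\<in>{..<Suc n}. A i)} \<in> u n"
      by (intro ultrafilter_mono[OF n(2,1)]) blast+
  qed (use Suc in auto)
  then show ?case by simp
qed simp

lemma ultra_all_True:
  assumes "\<And>i. i < n \<Longrightarrow> u i \<in> ultrafilters X"
  shows "ultra_all X u n (\<lambda>x. True)"
  using assms by (induction n) (auto simp: ultrafilter_top)

text \<open>Without a witness the negation would be true of all tuples, hence under the quantifier,
  against \<open>ultra_all_not\<close>.\<close>

lemma ultra_all_exists: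
  assumes "\<And>i. i < n \<Longrightarrow> u i \<in> ultrafilters X" and "ultra_all X u n \<phi>"
  shows "\<exists>x\<in>tuples X n. \<phi> x"
proof (rule ccontr)
  assume "\<not> ?thesis"
  then have "ultra_all X u n (\<lambda>x. \<not> \<phi> x) = ultra_all X u n (\<lambda>x. True)"
    by (intro ultra_all_cong) auto
  then show False using assms by (simp add: ultra_all_not ultra_all_True)
qed

text \<open>A principal ultrafilter quantifies over a single point. Here \<open>a\<close> may take
  any values outside \<open>{..<n}\<close>, so that the same \<open>a\<close> serves every shorter
  prefix in the induction.\<close>

lemma ultra_all_principal_restrict:
  assumes "\<And>i. i < n \<Longrightarrow> a i \<in> X \<and> u i = principal_on X (a i)"
  shows "ultra_all X u n \<phi> \<longleftrightarrow> \<phi> (restrict a {..<n})"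
  using assms
proof (induction n arbitrary: \<phi>)
  case (Suc n)
  have step: "ultra_all X u (Suc n) \<phi> \<longleftrightarrow> {y \<in> X. \<phi> ((restrict a {..<n})(n := y))} \<in> u n"
    unfolding ultra_all.simps by (rule Suc.IH) (use Suc.prems in auto)
  have "{y \<in> X. \<phi> ((restrict a {..<n})(n := y))} \<in> u n \<longleftrightarrow> \<phi> ((restrict a {..<n})(n := a n))"
    using Suc.prems[of n] by (simp add: principal_on_def del: restrict_upd)
  moreover have "(restrict a {..<n})(n := a n) = restrict a {..<Suc n}"
    by (auto simp: fun_eq_iff less_Suc_eq)
  ultimately show ?case by (simp only: step)
qed (simp add: restrict_def)

lemma ultra_all_principal:
  assumes "a \<in> tuples X n"
  shows "ultra_all X (map_tuple n (principal_on X) a) n \<phi> \<longleftrightarrow> \<phi> a"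
proof -
  have "restrict a {..<n} = a" using assms by (auto simp: PiE_iff extensional_restrict)
  then show ?thesis
    using assms ultra_all_principal_restrict[of n a X "map_tuple n (principal_on X) a" \<phi>]
    by (auto simp: map_tuple_apply)
qed

text \<open>The source of right continuity. Principal quantifiers before position \<open>i\<close>
  just substitute points, and those after \<open>i\<close> do not depend on \<open>z\<close>; what
  remains is one quantifier over \<open>z\<close>, that is, membership of a fixed set in
  \<open>z\<close>.\<close>

lemma ultra_all_clopen:
  assumes "\<And>j. j < i \<Longrightarrow> u j \<in> principal_on X ` X" and "i < n"
  shows "\<exists>B\<subseteq>X. \<forall>z. ultra_all X (u(i := z)) n \<phi> \<longleftrightarrow> B \<in> z"
  using assms(2)
proof (induction n arbitrary: \<phi>)
  case (Suc n)
  show ?case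
  proof (cases "n = i")
    case True
    have "\<forall>j. j < i \<longrightarrow> (\<exists>x. x \<in> X \<and> u j = principal_on X x)" using assms(1) by blast
    then obtain a where a: "\<forall>j. j < i \<longrightarrow> a j \<in> X \<and> u j = principal_on X (a j)" by metis
    have "ultra_all X (u(i := z)) i \<psi> \<longleftrightarrow> \<psi> (restrict a {..<i})" for z \<psi>
      by (rule ultra_all_principal_restrict) (use a in simp)
    then have "ultra_all X (u(i := z)) (Suc n) \<phi> \<longleftrightarrow> {y \<in> X. \<phi> ((restrict a {..<i})(i := y))} \<in> z" for z
      using True by (simp del: restrict_upd)
    then show ?thesis by (intro exI[of _ "{y \<in> X. \<phi> ((restrict a {..<i})(i := y))}"]) blast
  next
    case False
    then have "i < n" using Suc.prems by simp
    \<comment> \<open>As \<open>n \<noteq> i\<close>, the innermost quantifier uses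
      \<open>u n\<close> whatever \<open>z\<close> is, so it is absorbed into the predicate.\<close>
    from Suc.IH[OF this, of "\<lambda>x. {y \<in> X. \<phi> (x(n := y))} \<in> u n"] show ?thesis
      using False by simp
  qed
qed simp


section \<open>Right continuous extensions\<close>

text \<open>Admitting ultrafilters as values of \<open>G\<close> covers two cases at once:
  \<open>fun_tilde\<close> has principal values \<open>G x\<close>, while \<open>e_fun\<close> has
  the evaluations of an ultrafilter on operations.\<close>

definition right_extension ::
    "'a set \<Rightarrow> 'b set \<Rightarrow> nat \<Rightarrow> ((nat \<Rightarrow> 'a) \<Rightarrow> 'b set set) \<Rightarrow> (nat \<Rightarrow> 'a set set) \<Rightarrow> 'b set set" where
  "right_extension X Z n G =
     (\<lambda>u \<in> tuples (ultrafilters X) n. {A. A \<subseteq> Z \<and> ultra_all X u n (\<lambda>x. A \<in> G x)})"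

text \<open>Each ultrafilter law holds for every \<open>G x\<close> and is carried through
  \<open>ultra_all\<close>, which commutes with the Boolean connectives.\<close>

lemma right_extension_in_ultrafilters:
  assumes G: "G \<in> tuples X n \<rightarrow> ultrafilters Z" and u: "u \<in> tuples (ultrafilters X) n"
  shows "right_extension X Z n G u \<in> ultrafilters Z"
proof -
  have ui: "\<And>i. i < n \<Longrightarrow> u i \<in> ultrafilters X" using u by auto
  have Gx: "G x \<in> ultrafilters Z" if "x \<in> tuples X n" for x using G that by auto
  have iff: "A \<in> right_extension X Z n G u \<longleftrightarrow> A \<subseteq> Z \<and> ultra_all X u n (\<lambda>x. A \<in> G x)" for A
    using u by (simp add: right_extension_def)
  show ?thesis
  proof (rule ultrafiltersI)
    have "ultra_all X u n (\<lambda>x. Z \<in> G x)"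
      by (rule ultra_all_mono[OF ui _ ultra_all_True[OF ui]]) (auto intro: ultrafilter_top Gx)
    then show "Z \<in> right_extension X Z n G u" by (simp add: iff)
    have "{} \<notin> G x" if "x \<in> tuples X n" for x using ultrafilter_empty[OF Gx[OF that]] .
    then show "{} \<notin> right_extension X Z n G u"
      unfolding iff using ultra_all_exists[of n u X "\<lambda>x. {} \<in> G x"] ui by blast
  next
    fix A B assume "A \<in> right_extension X Z n G u" "B \<in> right_extension X Z n G u"
    then have *: "A \<subseteq> Z" "ultra_all X u n (\<lambda>x. A \<in> G x \<and> B \<in> G x)"
      unfolding iff by (auto simp: ultra_all_conj ui)
    have "ultra_all X u n (\<lambda>x. A \<inter> B \<in> G x)"
      by (rule ultra_all_mono[OF ui _ *(2)]) (auto intro: ultrafilter_Int[OF Gx])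
    then show "A \<inter> B \<in> right_extension X Z n G u" using * by (auto simp: iff)
  next
    fix A B assume "A \<in> right_extension X Z n G u" and B: "A \<subseteq> B" "B \<subseteq> Z"
    then have *: "ultra_all X u n (\<lambda>x. A \<in> G x)" unfolding iff by simp
    have "ultra_all X u n (\<lambda>x. B \<in> G x)"
      by (rule ultra_all_mono[OF ui _ *]) (use B in \<open>auto intro: ultrafilter_mono[OF Gx]\<close>)
    then show "B \<in> right_extension X Z n G u" using B by (simp add: iff)
  next
    fix A assume A: "A \<subseteq> Z"
    have "ultra_all X u n (\<lambda>x. Z - A \<in> G x) = ultra_all X u n (\<lambda>x. \<not> A \<in> G x)"
      by (rule ultra_all_cong) (simp add: ultrafilter_Diff_iff[OF Gx A])
    then show "A \<in> right_extension X Z n G u \<or> Z - A \<in> right_extension X Z n G u"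
      using A by (auto simp: iff ultra_all_not ui)
  qed (auto simp: iff)
qed

lemma right_extension_principal:
  assumes "G \<in> tuples X n \<rightarrow> ultrafilters Z" "a \<in> tuples X n"
  shows "right_extension X Z n G (map_tuple n (principal_on X) a) = G a"
proof -
  have "map_tuple n (principal_on X) a \<in> tuples (ultrafilters X) n"
    by (rule map_tuple_in_tuples[OF principal_on_funcset assms(2)])
  moreover have "A \<subseteq> Z" if "A \<in> G a" for A
    using assms that ultrafilter_subset[of "G a" Z] by auto
  ultimately show ?thesis
    using assms by (auto simp: right_extension_def ultra_all_principal)
qed

text \<open>With the earlier arguments principal, \<open>ultra_all_clopen\<close> shows that the
  preimage of a basic open set in the \<open>i\<close>-th argument is again basic.\<close>

lemma right_extension_right_continuous:
  assumes G: "G \<in> tuples X n \<rightarrow> ultrafilters Z"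
  shows "right_extension X Z n G \<in>
    right_continuous (ultrafilter_topology X) (principal_on X ` X) n (ultrafilter_topology Z)"
  unfolding right_continuous_def
proof (intro CollectI conjI allI impI ballI)
  show "right_extension X Z n G \<in>
      tuples (topspace (ultrafilter_topology X)) n \<rightarrow>\<^sub>E topspace (ultrafilter_topology Z)"
    using right_extension_in_ultrafilters[OF G]
    by (auto simp: PiE_iff right_extension_def)
  fix i a assume i: "i < n" and a: "a \<in> tuples (topspace (ultrafilter_topology X)) n"
    and princ: "\<forall>j<i. a j \<in> principal_on X ` X"
  have upd: "a(i := z) \<in> tuples (ultrafilters X) n" if "z \<in> ultrafilters X" for z
    using a i that by (intro tuples_upd) auto
  show "continuous_map (ultrafilter_topology X) (ultrafilter_topology Z)
      (\<lambda>z. right_extension X Z n G (a(i := z)))"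
  proof (rule continuous_map_into_ultrafilter_topology)
    show "(\<lambda>z. right_extension X Z n G (a(i := z))) \<in> topspace (ultrafilter_topology X) \<rightarrow> ultrafilters Z"
      using right_extension_in_ultrafilters[OF G] upd by auto
    fix A assume A: "A \<subseteq> Z"
    obtain B where B: "B \<subseteq> X" "\<And>z. ultra_all X (a(i := z)) n (\<lambda>x. A \<in> G x) \<longleftrightarrow> B \<in> z"
      using ultra_all_clopen[OF _ i, of a X "\<lambda>x. A \<in> G x"] princ by blast
    have "{z \<in> topspace (ultrafilter_topology X). A \<in> right_extension X Z n G (a(i := z))} =
        {z \<in> ultrafilters X. B \<in> z}"
      using A upd B(2) by (auto simp: right_extension_def)
    then show "openin (ultrafilter_topology X)
        {z \<in> topspace (ultrafilter_topology X). A \<in> right_extension X Z n G (a(i := z))}"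
      using B(1) by (simp add: openin_ultrafilter_basic)
  qed
qed

lemma fun_tilde_eq_right_extension:
  "fun_tilde X n f = right_extension X X n (\<lambda>x. principal_on X (f x))"
  unfolding fun_tilde_def right_extension_def
proof (rule restrict_ext, rule Collect_cong)
  fix u A
  show "(A \<subseteq> X \<and> ultra_all X u n (\<lambda>x. f x \<in> A)) \<longleftrightarrow>
      (A \<subseteq> X \<and> ultra_all X u n (\<lambda>x. A \<in> principal_on X (f x)))"
    by (cases "A \<subseteq> X") (simp_all add: principal_on_iff)
qed

lemma principal_on_operation: "f \<in> operations X n \<Longrightarrow> (\<lambda>x. principal_on X (f x)) \<in> tuples X n \<rightarrow> ultrafilters X"
  by (auto intro: principal_on_ultrafilter)

lemma fun_tilde_RC: "f \<in> operations X n \<Longrightarrow> fun_tilde X n f \<in> RC X n"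
  unfolding RC_def fun_tilde_eq_right_extension
  by (rule right_extension_right_continuous) (rule principal_on_operation)

lemma fun_tilde_principal:
  "f \<in> operations X n \<Longrightarrow> a \<in> tuples X n \<Longrightarrow>
    fun_tilde X n f (map_tuple n (principal_on X) a) = principal_on X (f a)"
  unfolding fun_tilde_eq_right_extension
  using right_extension_principal[OF principal_on_operation] .

lemma rel_tilde_principal:
  "a \<in> tuples X n \<Longrightarrow> map_tuple n (principal_on X) a \<in> rel_tilde X n Q \<longleftrightarrow> a \<in> Q"
  by (simp add: rel_tilde_def ultra_all_principal map_tuple_in_tuples[OF principal_on_funcset])

lemma rel_tilde_RC_rel: "rel_tilde X n Q \<in> RC_rel X n"
  unfolding RC_rel_def right_continuous_def
proof (intro CollectI conjI allI impI ballI)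
  fix i a assume i: "i < n" and a: "a \<in> tuples (topspace (ultrafilter_topology X)) n"
    and princ: "\<forall>j<i. a j \<in> principal_on X ` X"
  obtain B where B: "B \<subseteq> X" "\<And>z. ultra_all X (a(i := z)) n (\<lambda>x. x \<in> Q) \<longleftrightarrow> B \<in> z"
    using ultra_all_clopen[OF _ i, of a X "\<lambda>x. x \<in> Q"] princ by blast
  have "a(i := z) \<in> tuples (ultrafilters X) n" if "z \<in> ultrafilters X" for z
    using a i that by (intro tuples_upd) auto
  then show "continuous_map (ultrafilter_topology X) (discrete_topology UNIV)
      (\<lambda>z. (\<lambda>u\<in>tuples (ultrafilters X) n. u \<in> rel_tilde X n Q) (a(i := z)))"
    by (intro continuous_map_eq[OF continuous_map_ultrafilter_to_bool[OF B(1)]])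
      (simp add: rel_tilde_def B(2))
qed (auto simp: rel_tilde_def)

section \<open>Uniqueness of right continuous maps\<close>

lemma right_continuousD:
  assumes "f \<in> right_continuous T A n T'" "i < n" "u \<in> tuples (topspace T) n" "\<And>j. j < i \<Longrightarrow> u j \<in> A"
  shows "continuous_map T T' (\<lambda>z. f (u(i := z)))"
  using assms unfolding right_continuous_def by blast

text \<open>Arguments are released from being principal one at a time, beginning with the last, by
  continuity and density. Continuity is assumed of \<open>f\<close> and \<open>g\<close> directly
  rather than through \<open>right_continuous\<close>, so that composites with the extension of
  \<open>h\<close>, which need not be extensional, are covered.\<close>

lemma right_continuous_unique:
  assumes T: "Hausdorff_space T"
    and f: "\<And>i u. i < n \<Longrightarrow> u \<in> tuples (ultrafilters X) n \<Longrightarrow> (\<And>j. j < i \<Longrightarrow> u j \<in> principal_on X ` X)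
      \<Longrightarrow> continuous_map (ultrafilter_topology X) T (\<lambda>z. f (u(i := z)))"
    and g: "\<And>i u. i < n \<Longrightarrow> u \<in> tuples (ultrafilters X) n \<Longrightarrow> (\<And>j. j < i \<Longrightarrow> u j \<in> principal_on X ` X)
      \<Longrightarrow> continuous_map (ultrafilter_topology X) T (\<lambda>z. g (u(i := z)))"
    and eq: "\<And>u. u \<in> principal_tuples X n \<Longrightarrow> f u = g u"
    and u: "u \<in> tuples (ultrafilters X) n"
  shows "f u = g u"
proof -
  \<comment> \<open>Here \<open>k\<close> counts the trailing arguments that may be arbitrary. The
    case \<open>k = 0\<close> is agreement on principal tuples, and \<open>k = n\<close> is the
    goal.\<close>
  have "k \<le> n \<Longrightarrow> \<forall>u\<in>tuples (ultrafilters X) n. (\<forall>j<n - k. u j \<in> principal_on X ` X) \<longrightarrow> f u = g u" for k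
  proof (induction k)
    case 0
    show ?case using eq by (auto simp: PiE_iff)
  next
    case (Suc k)
    show ?case
    proof (intro ballI impI)
      fix u assume u: "u \<in> tuples (ultrafilters X) n" "\<forall>j<n - Suc k. u j \<in> principal_on X ` X"
      define i where "i = n - Suc k"
      have i: "i < n" "n - k = Suc i" using Suc.prems by (auto simp: i_def)
      \<comment> \<open>The trivial update exhibits \<open>u\<close> as a point of a section in
        argument \<open>i\<close>. On this section the two maps agree at principal ultrafilters by
        the induction hypothesis.\<close>
      have "f (u(i := u i)) = g (u(i := u i))"
      proof (rule forall_in_closure_of_eq[OF closure_of_principal T])
        show "u i \<in> ultrafilters X" using u i by auto
        show "continuous_map (ultrafilter_topology X) T (\<lambda>z. f (u(i := z)))"
          "continuous_map (ultrafilter_topology X) T (\<lambda>z. g (u(i := z)))"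
          by (rule f g; use u i in \<open>simp add: i_def\<close>)+
        fix p assume p: "p \<in> principal_on X ` X"
        then have "u(i := p) \<in> tuples (ultrafilters X) n"
          using u i by (intro tuples_upd) (auto intro: principal_on_ultrafilter)
        moreover have "\<forall>j<n - k. (u(i := p)) j \<in> principal_on X ` X"
          using u(2) p i by (auto simp: i_def less_Suc_eq)
        ultimately show "f (u(i := p)) = g (u(i := p))" using Suc by simp
      qed
      then show "f u = g u" by simp
    qed
  qed
  from this[of n] show ?thesis using u by simp
qed

lemma right_continuous_eqI:
  assumes "Hausdorff_space T"
    and f: "f \<in> right_continuous (ultrafilter_topology X) (principal_on X ` X) n T"
    and g: "g \<in> right_continuous (ultrafilter_topology X) (principal_on X ` X) n T"
    and "\<And>u. u \<in> principal_tuples X n \<Longrightarrow> f u = g u" "u \<in> tuples (ultrafilters X) n"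
  shows "f u = g u"
  by (rule right_continuous_unique[OF assms(1) _ _ assms(4,5)])
    (rule right_continuousD[OF f] right_continuousD[OF g]; simp del: fun_upd_apply)+


section \<open>The extension map and its values\<close>

text \<open>This makes pointwise convergence on principal tuples a Hausdorff topology on
  \<open>RC X n\<close>, so that \<open>e_fun\<close> and the limits in \<open>RC_topology\<close>
  are well determined.\<close>

lemma inj_on_RC: "inj_on (\<lambda>f. restrict f (principal_tuples X n)) (RC X n)"
proof (rule inj_onI)
  fix f g assume f: "f \<in> RC X n" and g: "g \<in> RC X n"
    and eq: "restrict f (principal_tuples X n) = restrict g (principal_tuples X n)"
  show "f = g"
  proof (rule extensionalityI)
    show "f \<in> extensional (tuples (ultrafilters X) n)" "g \<in> extensional (tuples (ultrafilters X) n)"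
      using f g by (auto simp: RC_def right_continuous_def PiE_iff)
    fix u assume "u \<in> tuples (ultrafilters X) n"
    then show "f u = g u"
    proof (rule right_continuous_eqI[OF Hausdorff_ultrafilter_topology f[unfolded RC_def] g[unfolded RC_def], rotated])
      show "f p = g p" if "p \<in> principal_tuples X n" for p
        using fun_cong[OF eq, of p] that by simp
    qed
  qed
qed

text \<open>The uniqueness of right continuous maps is applied to the characteristic functions, with
  values in the discrete space of truth values.\<close>

lemma inj_on_RC_rel: "inj_on (\<lambda>S. \<lambda>u\<in>principal_tuples X n. u \<in> S) (RC_rel X n)"
proof (rule inj_onI)
  fix S S' assume S: "S \<in> RC_rel X n" and S': "S' \<in> RC_rel X n"
    and eq: "(\<lambda>u\<in>principal_tuples X n. u \<in> S) = (\<lambda>u\<in>principal_tuples X n. u \<in> S')"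
  let ?c = "\<lambda>S. \<lambda>u\<in>tuples (ultrafilters X) n. u \<in> S"
  have sub: "principal_tuples X n \<subseteq> tuples (ultrafilters X) n"
    by (rule PiE_mono) (auto intro: principal_on_ultrafilter)
  have "?c S u = ?c S' u" if "u \<in> tuples (ultrafilters X) n" for u
  proof (rule right_continuous_eqI[OF _ _ _ _ that])
    show "Hausdorff_space (discrete_topology (UNIV :: bool set))" by simp
    show "?c S \<in> right_continuous (ultrafilter_topology X) (principal_on X ` X) n (discrete_topology UNIV)"
      "?c S' \<in> right_continuous (ultrafilter_topology X) (principal_on X ` X) n (discrete_topology UNIV)"
      using S S' unfolding RC_rel_def by blast+
    fix p assume p: "p \<in> principal_tuples X n"
    then show "?c S p = ?c S' p" using sub fun_cong[OF eq, of p] by auto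
  qed
  then show "S = S'" using S S' unfolding RC_rel_def by auto
qed

lemma Hausdorff_RC_topology: "Hausdorff_space (RC_topology X n)"
  unfolding RC_topology_def
  by (rule Hausdorff_pullback_topology)
    (auto simp: Hausdorff_space_product_topology Hausdorff_ultrafilter_topology inj_on_RC)

lemma Hausdorff_RC_rel_topology: "Hausdorff_space (RC_rel_topology X n)"
  unfolding RC_rel_topology_def
  by (rule Hausdorff_pullback_topology) (auto simp: Hausdorff_space_product_topology inj_on_RC_rel)

text \<open>For \<open>x\<close> a tuple over \<open>X\<close>, this is the set that
  pseudo-principality requires to be principal.\<close>

definition eval_ultrafilter ::
    "'a set \<Rightarrow> nat \<Rightarrow> ((nat \<Rightarrow> 'a) \<Rightarrow> 'a) set set \<Rightarrow> (nat \<Rightarrow> 'a) \<Rightarrow> 'a set set" where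
  "eval_ultrafilter X n \<ff> x = image_ultrafilter (operations X n) X (\<lambda>f. f x) \<ff>"

lemma eval_ultrafilter_funcset:
  "\<ff> \<in> ultrafilters (operations X n) \<Longrightarrow> eval_ultrafilter X n \<ff> \<in> tuples X n \<rightarrow> ultrafilters X"
  unfolding eval_ultrafilter_def by (auto intro!: image_ultrafilter_in_ultrafilters)

text \<open>The right side depends continuously on the ultrafilter, since its coordinate at a
  principal tuple is a pushforward, and at the principal ultrafilter of \<open>f\<close> it is
  \<open>fun_tilde X n f\<close>. Uniqueness of the extension does the rest.\<close>

lemma e_fun_eq:
  assumes "\<ff> \<in> ultrafilters (operations X n)"
  shows "e_fun X n \<ff> = right_extension X X n (eval_ultrafilter X n \<ff>)"
proof -
  let ?g = "\<lambda>\<ff>. right_extension X X n (eval_ultrafilter X n \<ff>)"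
  have "e_fun X n = restrict ?g (ultrafilters (operations X n))"
    unfolding e_fun_def
  proof (rule continuous_extension_unique[OF Hausdorff_RC_topology])
    show "continuous_map (ultrafilter_topology (operations X n)) (RC_topology X n) ?g"
      unfolding RC_topology_def
    proof (rule continuous_map_pullback')
      show "topspace (ultrafilter_topology (operations X n)) \<subseteq> ?g -` RC X n"
        using right_extension_right_continuous[OF eval_ultrafilter_funcset] by (auto simp: RC_def)
      show "continuous_map (ultrafilter_topology (operations X n))
          (product_topology (\<lambda>_. ultrafilter_topology X) (principal_tuples X n))
          ((\<lambda>f. restrict f (principal_tuples X n)) \<circ> ?g)"
      proof (rule continuous_map_coordinatewise_then_product)
        fix p assume "p \<in> principal_tuples X n"
        then obtain a where a: "a \<in> tuples X n" "p = map_tuple n (principal_on X) a"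
          by (rule principal_tuplesE)
        have "continuous_map (ultrafilter_topology (operations X n)) (ultrafilter_topology X)
            (\<lambda>\<ff>. eval_ultrafilter X n \<ff> a)"
          unfolding eval_ultrafilter_def
          by (rule continuous_map_image_ultrafilter) (use a in auto)
        then show "continuous_map (ultrafilter_topology (operations X n)) (ultrafilter_topology X)
            (\<lambda>\<ff>. ((\<lambda>f. restrict f (principal_tuples X n)) \<circ> ?g) \<ff> p)"
          by (rule continuous_map_eq)
            (use a \<open>p \<in> principal_tuples X n\<close> in
              \<open>simp add: right_extension_principal[OF eval_ultrafilter_funcset]\<close>)
      qed auto
    qed
  next
    fix f assume f: "f \<in> operations X n"
    have "eval_ultrafilter X n (principal_on (operations X n) f) x = principal_on X (f x)"
      if "x \<in> tuples X n" for x
      unfolding eval_ultrafilter_def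
      by (rule image_ultrafilter_principal_on) (use f that in auto)
    then show "?g (principal_on (operations X n) f) = fun_tilde X n f"
      unfolding fun_tilde_eq_right_extension right_extension_def
      by (auto intro!: restrict_ext Collect_cong conj_cong ultra_all_cong)
  qed
  then show ?thesis using assms by simp
qed

text \<open>The limit of \<open>\<rr>\<close> in the space of relations, computed coordinatewise as
  a point of the Cantor cube over \<open>tuples X n\<close>.\<close>

definition limit_relation :: "'a set \<Rightarrow> nat \<Rightarrow> (nat \<Rightarrow> 'a) set set set \<Rightarrow> (nat \<Rightarrow> 'a) set" where
  "limit_relation X n \<rr> = {x \<in> tuples X n. {Q \<in> relations X n. x \<in> Q} \<in> \<rr>}"

lemma limit_relation_in_relations: "limit_relation X n \<rr> \<in> relations X n"
  by (auto simp: limit_relation_def)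

text \<open>Again uniqueness of the extension: on principal tuples the coordinates of the right side
  are the clopen conditions \<open>{Q \<in> relations X n. a \<in> Q} \<in> \<rr>\<close>. Thus
  \<open>e_rel\<close> takes no values beyond those of \<open>rel_tilde\<close>.\<close>

lemma e_rel_eq:
  assumes "\<rr> \<in> ultrafilters (relations X n)"
  shows "e_rel X n \<rr> = rel_tilde X n (limit_relation X n \<rr>)"
proof -
  let ?g = "\<lambda>\<rr>. rel_tilde X n (limit_relation X n \<rr>)"
  have "e_rel X n = restrict ?g (ultrafilters (relations X n))"
    unfolding e_rel_def
  proof (rule continuous_extension_unique[OF Hausdorff_RC_rel_topology])
    show "continuous_map (ultrafilter_topology (relations X n)) (RC_rel_topology X n) ?g"
      unfolding RC_rel_topology_def
    proof (rule continuous_map_pullback')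
      show "continuous_map (ultrafilter_topology (relations X n))
          (product_topology (\<lambda>_. discrete_topology UNIV) (principal_tuples X n))
          ((\<lambda>S. \<lambda>u\<in>principal_tuples X n. u \<in> S) \<circ> ?g)"
      proof (rule continuous_map_coordinatewise_then_product)
        fix p assume p: "p \<in> principal_tuples X n"
        then obtain a where a: "a \<in> tuples X n" "p = map_tuple n (principal_on X) a"
          by (rule principal_tuplesE)
        have "continuous_map (ultrafilter_topology (relations X n)) (discrete_topology UNIV)
            (\<lambda>\<rr>. {Q \<in> relations X n. a \<in> Q} \<in> \<rr>)"
          by (rule continuous_map_ultrafilter_to_bool) auto
        then show "continuous_map (ultrafilter_topology (relations X n)) (discrete_topology UNIV)
            (\<lambda>\<rr>. ((\<lambda>S. \<lambda>u\<in>principal_tuples X n. u \<in> S) \<circ> ?g) \<rr> p)"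
          by (rule continuous_map_eq) (use a p in \<open>simp add: rel_tilde_principal limit_relation_def\<close>)
      qed auto
    qed (auto simp: rel_tilde_RC_rel)
  next
    fix Q assume "Q \<in> relations X n"
    then have "limit_relation X n (principal_on (relations X n) Q) = Q"
      by (auto simp: limit_relation_def principal_on_def)
    then show "?g (principal_on (relations X n) Q) = rel_tilde X n Q" by simp
  qed
  then show ?thesis using assms by simp
qed


section \<open>Limits of the interpretations of the wide model\<close>

lemma RC_subset_operations: "RC X n \<subseteq> operations (ultrafilters X) n"
  by (auto simp: RC_def right_continuous_def)

lemma I_fun_eq_image_ultrafilter:
  "I_fun X n \<ff> = image_ultrafilter (operations X n) (operations (ultrafilters X) n) (fun_tilde X n) \<ff>"
  by (simp add: I_fun_def image_ultrafilter_def)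

lemma I_rel_eq_image_ultrafilter:
  "I_rel X n \<rr> = image_ultrafilter (relations X n) (relations (ultrafilters X) n) (rel_star X n) \<rr>"
  by (simp add: I_rel_def image_ultrafilter_def)

lemma fun_tilde_funcset_RC: "fun_tilde X n \<in> operations X n \<rightarrow> RC X n"
  by (rule Pi_I) (rule fun_tilde_RC)

text \<open>Convergence is tested only at principal tuples, where \<open>fun_tilde X n f\<close> has
  the value \<open>principal_on X (f a)\<close>. The assumption on evaluations says that
  \<open>f a\<close> lies in \<open>A\<close> for \<open>\<ff>\<close>-almost all \<open>f\<close>
  as soon as \<open>g a\<close> does.\<close>

lemma ultra_limit_I_fun:
  assumes \<ff>: "\<ff> \<in> ultrafilters (operations X n)" and g: "g \<in> operations X n"
    and eval: "\<And>a. a \<in> tuples X n \<Longrightarrow> eval_ultrafilter X n \<ff> a = principal_on X (g a)"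
  shows "ultra_limit (RC_topology X n) (I_fun X n \<ff>) = fun_tilde X n g"
proof (rule ultra_limit_eqI[OF Hausdorff_RC_topology])
  show "I_fun X n \<ff> \<in> ultrafilters (operations (ultrafilters X) n)"
    unfolding I_fun_eq_image_ultrafilter
    by (rule image_ultrafilter_in_ultrafilters[OF \<ff> Pi_mono[THEN subsetD, OF _ fun_tilde_funcset_RC]])
      (rule RC_subset_operations)
  show "ultra_converges (RC_topology X n) (I_fun X n \<ff>) (fun_tilde X n g)"
    unfolding I_fun_eq_image_ultrafilter RC_topology_def
  proof (rule ultra_converges_pullback_product[OF \<ff> fun_tilde_funcset_RC RC_subset_operations fun_tilde_RC[OF g]])
    have sub: "principal_tuples X n \<subseteq> tuples (ultrafilters X) n"
      by (rule PiE_mono) (auto intro: principal_on_ultrafilter)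
    show "(\<lambda>f. restrict f (principal_tuples X n)) \<in>
        RC X n \<rightarrow> (\<Pi>\<^sub>E p\<in>principal_tuples X n. topspace (ultrafilter_topology X))"
    proof (rule Pi_I, unfold restrict_PiE_iff, rule ballI)
      fix f p assume "f \<in> RC X n" "p \<in> principal_tuples X n"
      then show "f p \<in> topspace (ultrafilter_topology X)"
        using RC_subset_operations[of X n] sub PiE_mem[of f "tuples (ultrafilters X) n" "\<lambda>_. ultrafilters X" p]
        by (simp add: subset_iff)
    qed
    fix p V assume p: "p \<in> principal_tuples X n" and V: "openin (ultrafilter_topology X) V"
      and gV: "restrict (fun_tilde X n g) (principal_tuples X n) p \<in> V"
    obtain a where a: "a \<in> tuples X n" "p = map_tuple n (principal_on X) a"
      using p by (rule principal_tuplesE)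
    have val: "restrict (fun_tilde X n f) (principal_tuples X n) p = principal_on X (f a)"
      if "f \<in> operations X n" for f
      using fun_tilde_principal[OF that a(1)] p a(2) by simp
    obtain A where A: "A \<in> principal_on X (g a)" "{v \<in> ultrafilters X. A \<in> v} \<subseteq> V"
      by (rule ultrafilter_topology_base[OF V gV[unfolded val[OF g]]])
    have "A \<subseteq> X" using A(1) by (simp add: principal_on_def)
    have "A \<in> eval_ultrafilter X n \<ff> a" using A(1) eval[OF a(1)] by simp
    then have "{f \<in> operations X n. f a \<in> A} \<in> \<ff>"
      by (simp add: eval_ultrafilter_def image_ultrafilter_def)
    then show "{f \<in> operations X n. restrict (fun_tilde X n f) (principal_tuples X n) p \<in> V} \<in> \<ff>"
    proof (rule ultrafilter_mono[OF \<ff>])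
      show "{f \<in> operations X n. f a \<in> A} \<subseteq>
          {f \<in> operations X n. restrict (fun_tilde X n f) (principal_tuples X n) p \<in> V}"
      proof (rule subsetI)
        fix f assume f: "f \<in> {f \<in> operations X n. f a \<in> A}"
        then have "principal_on X (f a) \<in> {v \<in> ultrafilters X. A \<in> v}"
          using \<open>A \<subseteq> X\<close> by (auto simp: principal_on_iff intro: principal_on_ultrafilter)
        then have "restrict (fun_tilde X n f) (principal_tuples X n) p \<in> V"
          using A(2) val[of f] f by auto
        then show "f \<in> {f \<in> operations X n. restrict (fun_tilde X n f) (principal_tuples X n) p \<in> V}"
          using f by blast
      qed
    qed blast
  qed
qed

section \<open>Star extensions of relations and the space of regular closed sets\<close>

lemma rel_starI:
  assumes "u \<in> tuples (ultrafilters X) n"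
    and "\<And>A. (\<And>i. i < n \<Longrightarrow> A i \<in> u i) \<Longrightarrow> Q \<inter> (\<Pi>\<^sub>E i\<in>{..<n}. A i) \<noteq> {}"
  shows "u \<in> rel_star X n Q"
  unfolding rel_star_def
proof (intro CollectI conjI allI impI)
  show "Q \<inter> (\<Pi>\<^sub>E i\<in>{..<n}. A i) \<noteq> {}" if "\<forall>i<n. A i \<in> u i" for A
    by (rule assms(2)) (simp add: that)
qed (rule assms(1))

lemma rel_starD:
  assumes "u \<in> rel_star X n Q" "\<And>i. i < n \<Longrightarrow> A i \<in> u i"
  shows "Q \<inter> (\<Pi>\<^sub>E i\<in>{..<n}. A i) \<noteq> {}"
proof -
  have "(\<forall>i<n. A i \<in> u i) \<longrightarrow> Q \<inter> (\<Pi>\<^sub>E i\<in>{..<n}. A i) \<noteq> {}"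
    using assms(1) unfolding rel_star_def by (elim CollectE conjE) (erule spec)
  then show ?thesis using assms(2) by simp
qed

text \<open>The singletons \<open>{a i}\<close> belong to the principal ultrafilters, and their box
  is \<open>{a}\<close>. Hence a relation can be read off from its star extension.\<close>

lemma rel_star_principal:
  assumes "a \<in> tuples X n"
  shows "map_tuple n (principal_on X) a \<in> rel_star X n Q \<longleftrightarrow> a \<in> Q"
proof
  assume mem: "map_tuple n (principal_on X) a \<in> rel_star X n Q"
  have "Q \<inter> (\<Pi>\<^sub>E i\<in>{..<n}. {a i}) \<noteq> {}"
    by (rule rel_starD[OF mem]) (use assms in \<open>auto simp: map_tuple_apply principal_on_def\<close>)
  moreover have "(\<Pi>\<^sub>E i\<in>{..<n}. {a i}) = {a}"
    by (rule PiE_singleton) (use assms in \<open>simp add: PiE_iff\<close>)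
  ultimately show "a \<in> Q" by simp
next
  assume a: "a \<in> Q"
  show "map_tuple n (principal_on X) a \<in> rel_star X n Q"
  proof (rule rel_starI)
    show "map_tuple n (principal_on X) a \<in> tuples (ultrafilters X) n"
      by (rule map_tuple_in_tuples[OF principal_on_funcset assms])
    fix A assume A: "\<And>i. i < n \<Longrightarrow> A i \<in> map_tuple n (principal_on X) a i"
    have "a \<in> (\<Pi>\<^sub>E i\<in>{..<n}. A i)"
    proof (rule PiE_I)
      show "a i \<in> A i" if "i \<in> {..<n}" for i
        using A[of i] that by (simp add: map_tuple_apply principal_on_def)
      show "a i = undefined" if "i \<notin> {..<n}" for i
        using assms that by (rule PiE_arb)
    qed
    then show "Q \<inter> (\<Pi>\<^sub>E i\<in>{..<n}. A i) \<noteq> {}" using a by blast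
  qed
qed

lemma inj_on_rel_star: "inj_on (rel_star X n) (relations X n)"
proof (rule inj_onI)
  fix Q Q' assume QQ': "Q \<in> relations X n" "Q' \<in> relations X n" and eq: "rel_star X n Q = rel_star X n Q'"
  have "a \<in> Q \<longleftrightarrow> a \<in> Q'" if "a \<in> tuples X n" for a
    using rel_star_principal[OF that, of Q] rel_star_principal[OF that, of Q'] eq by simp
  then show "Q = Q'" using QQ' by blast
qed

text \<open>The identification of regular closed sets with points of the cube: the inverse of
  \<open>rel_star\<close> followed by the characteristic function.\<close>

definition RegCl_char :: "'a set \<Rightarrow> nat \<Rightarrow> (nat \<Rightarrow> 'a set set) set \<Rightarrow> (nat \<Rightarrow> 'a) \<Rightarrow> bool" where
  "RegCl_char X n S = (\<lambda>x\<in>tuples X n. x \<in> inv_into (relations X n) (rel_star X n) S)"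

lemma RegCl_char_rel_star:
  "Q \<in> relations X n \<Longrightarrow> RegCl_char X n (rel_star X n Q) = (\<lambda>x\<in>tuples X n. x \<in> Q)"
  unfolding RegCl_char_def by (simp only: inv_into_f_f[OF inj_on_rel_star])

text \<open>Two successive pullbacks are merged into one, which brings the topology into the form
  handled by \<open>ultra_converges_pullback_product\<close>.\<close>

lemma RegCl_topology_eq:
  "RegCl_topology X n = pullback_topology (RegCl X n) (RegCl_char X n)
     (product_topology (\<lambda>_. discrete_topology UNIV) (tuples X n))"
proof -
  have "inv_into (relations X n) (rel_star X n) S \<in> relations X n" if "S \<in> RegCl X n" for S
    using that unfolding RegCl_def by (rule inv_into_into)
  then have "inv_into (relations X n) (rel_star X n) -`
        ((\<lambda>Q. \<lambda>x\<in>tuples X n. x \<in> Q) -` V \<inter> relations X n) \<inter> RegCl X n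
      = RegCl_char X n -` V \<inter> RegCl X n" for V
    unfolding RegCl_char_def by blast
  then show ?thesis
    unfolding topology_eq RegCl_topology_def relations_topology_def openin_pullback_topology
    by metis
qed

lemma Hausdorff_RegCl_topology: "Hausdorff_space (RegCl_topology X n)"
  unfolding RegCl_topology_eq
proof (rule Hausdorff_pullback_topology)
  show "inj_on (RegCl_char X n) (RegCl X n)"
  proof (rule inj_onI)
    fix S S' assume "S \<in> RegCl X n" "S' \<in> RegCl X n" and eq: "RegCl_char X n S = RegCl_char X n S'"
    then obtain Q Q' where Q: "Q \<in> relations X n" "S = rel_star X n Q"
      and Q': "Q' \<in> relations X n" "S' = rel_star X n Q'"
      unfolding RegCl_def by blast
    have "a \<in> Q \<longleftrightarrow> a \<in> Q'" if "a \<in> tuples X n" for a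
      using fun_cong[OF eq, of a] that
      unfolding Q(2) Q'(2) RegCl_char_rel_star[OF Q(1)] RegCl_char_rel_star[OF Q'(1)] by simp
    then have "Q = Q'" using Q(1) Q'(1) by blast
    then show "S = S'" using Q(2) Q'(2) by simp
  qed
qed (simp add: Hausdorff_space_product_topology)

text \<open>In the coordinates \<open>RegCl_char\<close> the set \<open>rel_star X n Q\<close> is
  just \<open>Q\<close>, so the limit is the star extension of the coordinatewise limit of
  \<open>\<rr>\<close>.\<close>

lemma ultra_limit_I_rel:
  assumes \<rr>: "\<rr> \<in> ultrafilters (relations X n)"
  shows "ultra_limit (RegCl_topology X n) (I_rel X n \<rr>) = rel_star X n (limit_relation X n \<rr>)"
proof (rule ultra_limit_eqI[OF Hausdorff_RegCl_topology])
  let ?Q = "limit_relation X n \<rr>"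
  have sub: "RegCl X n \<subseteq> relations (ultrafilters X) n"
    by (auto simp: RegCl_def rel_star_def)
  have star: "rel_star X n \<in> relations X n \<rightarrow> RegCl X n"
    unfolding RegCl_def by (rule Pi_I) (rule imageI)
  show "I_rel X n \<rr> \<in> ultrafilters (relations (ultrafilters X) n)"
    unfolding I_rel_eq_image_ultrafilter
    by (rule image_ultrafilter_in_ultrafilters[OF \<rr> Pi_mono[THEN subsetD, OF _ star]]) (rule sub)
  show "ultra_converges (RegCl_topology X n) (I_rel X n \<rr>) (rel_star X n ?Q)"
    unfolding I_rel_eq_image_ultrafilter RegCl_topology_eq
  proof (rule ultra_converges_pullback_product[OF \<rr> star sub])
    show "rel_star X n ?Q \<in> RegCl X n"
      unfolding RegCl_def by (rule imageI) (rule limit_relation_in_relations)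
    show "RegCl_char X n \<in> RegCl X n \<rightarrow> (\<Pi>\<^sub>E x\<in>tuples X n. topspace (discrete_topology UNIV))"
      by (auto simp: RegCl_char_def)
    fix a V assume a: "a \<in> tuples X n" and V: "RegCl_char X n (rel_star X n ?Q) a \<in> V"
    have val: "RegCl_char X n (rel_star X n Q) a = (a \<in> Q)" if "Q \<in> relations X n" for Q
      using a unfolding RegCl_char_rel_star[OF that] by simp
    \<comment> \<open>An ultrafilter decides whether \<open>a \<in> Q\<close>, and \<open>?Q\<close>
      records the decision. So the coordinate at \<open>a\<close> is constant on a member of
      \<open>\<rr>\<close>.\<close>
    have "{Q \<in> relations X n. (a \<in> Q) = (a \<in> ?Q)} \<in> \<rr>"
    proof (cases "a \<in> ?Q")
      case True
      then have "{Q \<in> relations X n. a \<in> Q} \<in> \<rr>" unfolding limit_relation_def by blast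
      then show ?thesis using True by simp
    next
      case False
      then have "{Q \<in> relations X n. a \<in> Q} \<notin> \<rr>" using a unfolding limit_relation_def by blast
      then have "relations X n - {Q \<in> relations X n. a \<in> Q} \<in> \<rr>"
        by (subst ultrafilter_Diff_iff[OF \<rr>]) auto
      moreover have "relations X n - {Q \<in> relations X n. a \<in> Q} = {Q \<in> relations X n. (a \<in> Q) = (a \<in> ?Q)}"
        using False by blast
      ultimately show ?thesis by simp
    qed
    then show "{Q \<in> relations X n. RegCl_char X n (rel_star X n Q) a \<in> V} \<in> \<rr>"
    proof (rule ultrafilter_mono[OF \<rr>])
      show "{Q \<in> relations X n. (a \<in> Q) = (a \<in> ?Q)} \<subseteq> {Q \<in> relations X n. RegCl_char X n (rel_star X n Q) a \<in> V}"
      proof (rule subsetI)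
        fix Q assume Q: "Q \<in> {Q \<in> relations X n. (a \<in> Q) = (a \<in> ?Q)}"
        have "RegCl_char X n (rel_star X n ?Q) a = (a \<in> ?Q)"
          by (rule val) (rule limit_relation_in_relations)
        moreover have "RegCl_char X n (rel_star X n Q) a = (a \<in> Q)" using Q val[of Q] by blast
        ultimately show "Q \<in> {Q \<in> relations X n. RegCl_char X n (rel_star X n Q) a \<in> V}"
          using V Q by auto
      qed
    qed blast
  qed
qed


section \<open>Lifting homomorphisms\<close>

text \<open>Under the iterated quantifier a tuple lies in \<open>Q\<close> and in any given box of
  sets \<open>A i\<close> from \<open>u i\<close>. The conjunction then holds too, and it has a
  witness.\<close>

lemma rel_tilde_subset_rel_star: "rel_tilde X n Q \<subseteq> rel_star X n Q"
proof
  fix u assume "u \<in> rel_tilde X n Q"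
  then have u: "u \<in> tuples (ultrafilters X) n" "ultra_all X u n (\<lambda>x. x \<in> Q)"
    by (simp_all add: rel_tilde_def)
  have ui: "\<And>i. i < n \<Longrightarrow> u i \<in> ultrafilters X" using u(1) by auto
  show "u \<in> rel_star X n Q"
  proof (rule rel_starI[OF u(1)])
    fix A assume "\<And>i. i < n \<Longrightarrow> A i \<in> u i"
    with ui have "ultra_all X u n (\<lambda>x. x \<in> (\<Pi>\<^sub>E i\<in>{..<n}. A i))"
      by (rule ultra_all_PiE)
    then have "ultra_all X u n (\<lambda>x. x \<in> Q \<and> x \<in> (\<Pi>\<^sub>E i\<in>{..<n}. A i))"
      using u(2) by (simp only: ultra_all_conj[where u = u and X = X and n = n, OF ui] simp_thms)
    with ui have "\<exists>x\<in>tuples X n. x \<in> Q \<and> x \<in> (\<Pi>\<^sub>E i\<in>{..<n}. A i)"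
      by (rule ultra_all_exists)
    then show "Q \<inter> (\<Pi>\<^sub>E i\<in>{..<n}. A i) \<noteq> {}" by blast
  qed
qed

text \<open>Both sides are right continuous in \<open>u\<close> and agree on principal tuples, where
  the equation is \<open>hom\<close>.\<close>

lemma continuous_extension_fun_tilde:
  assumes T: "compact_space T" "Hausdorff_space T" and h: "h \<in> X \<rightarrow> topspace T"
    and f: "f \<in> operations X n" and G: "G \<in> right_continuous T (h ` X) n T"
    and hom: "\<And>a. a \<in> tuples X n \<Longrightarrow> h (f a) = G (map_tuple n h a)"
    and u: "u \<in> tuples (ultrafilters X) n"
  defines "H \<equiv> continuous_extension X T h"
  shows "H (fun_tilde X n f u) = G (map_tuple n H u)"
proof -
  have H: "continuous_map (ultrafilter_topology X) T H"
    and Hp: "\<And>x. x \<in> X \<Longrightarrow> H (principal_on X x) = h x"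
    unfolding H_def
    by (rule continuous_map_continuous_extension[OF T h], rule continuous_extension_principal_on[OF T h])
  have Hfun: "H \<in> ultrafilters X \<rightarrow> topspace T"
    using continuous_map_funspace[OF H] by simp
  show ?thesis
  proof (rule right_continuous_unique[OF T(2) _ _ _ u, where f = "\<lambda>u. H (fun_tilde X n f u)"])
    fix i v assume i: "i < n" and v: "v \<in> tuples (ultrafilters X) n"
      and princ: "\<And>j. j < i \<Longrightarrow> v j \<in> principal_on X ` X"
    have "continuous_map (ultrafilter_topology X) (ultrafilter_topology X) (\<lambda>z. fun_tilde X n f (v(i := z)))"
      by (rule right_continuousD[OF fun_tilde_RC[OF f, unfolded RC_def] i])
        (use v princ in \<open>simp_all only: topspace_ultrafilter_topology\<close>)
    then show "continuous_map (ultrafilter_topology X) T (\<lambda>z. H (fun_tilde X n f (v(i := z))))"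
      using continuous_map_compose[OF _ H] by (simp only: comp_def)
    have "continuous_map T T (\<lambda>y. G ((map_tuple n H v)(i := y)))"
    proof (rule right_continuousD[OF G i])
      show "map_tuple n H v \<in> tuples (topspace T) n" by (rule map_tuple_in_tuples[OF Hfun v])
      fix j assume j: "j < i"
      then obtain x where "x \<in> X" "v j = principal_on X x" using princ by blast
      then show "map_tuple n H v j \<in> h ` X" using j i Hp by (auto simp: map_tuple_apply)
    qed
    then show "continuous_map (ultrafilter_topology X) T (\<lambda>z. G (map_tuple n H (v(i := z))))"
      using continuous_map_compose[OF H] by (simp only: comp_def map_tuple_upd[OF i])
  next
    fix p assume "p \<in> principal_tuples X n"
    then obtain a where a: "a \<in> tuples X n" "p = map_tuple n (principal_on X) a"
      by (rule principal_tuplesE)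
    have "map_tuple n H p = map_tuple n h a"
      unfolding a(2) by (rule map_tuple_cong) (use a Hp in \<open>auto simp: map_tuple_apply\<close>)
    moreover have "f a \<in> X" using f a(1) by auto
    ultimately show "H (fun_tilde X n f p) = G (map_tuple n H p)"
      using fun_tilde_principal[OF f a(1)] Hp[of "f a"] hom[OF a(1)] a(2) by simp
  qed
qed

text \<open>If the image lay outside \<open>S\<close>, a box around it would miss \<open>S\<close>.
  Its pullback to members of the \<open>u i\<close> gives a box meeting \<open>Q\<close>, and a
  common point contradicts \<open>hom\<close>.\<close>

lemma continuous_extension_rel_star:
  assumes T: "compact_space T" "Hausdorff_space T" and h: "h \<in> X \<rightarrow> topspace T"
    and S: "closedin (product_topology (\<lambda>_. T) {..<n}) S"
    and hom: "\<And>a. a \<in> tuples X n \<Longrightarrow> a \<in> Q \<Longrightarrow> map_tuple n h a \<in> S"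
    and u: "u \<in> rel_star X n Q"
  defines "H \<equiv> continuous_extension X T h"
  shows "map_tuple n H u \<in> S"
proof (rule ccontr)
  assume notin: "map_tuple n H u \<notin> S"
  have H: "continuous_map (ultrafilter_topology X) T H"
    and Hp: "\<And>x. x \<in> X \<Longrightarrow> H (principal_on X x) = h x"
    unfolding H_def
    by (rule continuous_map_continuous_extension[OF T h], rule continuous_extension_principal_on[OF T h])
  have Hfun: "H \<in> ultrafilters X \<rightarrow> topspace T"
    using continuous_map_funspace[OF H] by simp
  have ut: "u \<in> tuples (ultrafilters X) n" using u by (simp add: rel_star_def)
  have "map_tuple n H u \<in> tuples (topspace T) n" by (rule map_tuple_in_tuples[OF Hfun ut])
  then have "map_tuple n H u \<in> topspace (product_topology (\<lambda>_. T) {..<n}) - S"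
    using notin by simp
  moreover have "openin (product_topology (\<lambda>_. T) {..<n}) (topspace (product_topology (\<lambda>_. T) {..<n}) - S)"
    using S by (simp add: closedin_def)
  ultimately obtain W where W: "\<And>i. i < n \<Longrightarrow> openin T (W i)" "map_tuple n H u \<in> Pi\<^sub>E {..<n} W"
      "Pi\<^sub>E {..<n} W \<subseteq> topspace (product_topology (\<lambda>_. T) {..<n}) - S"
    unfolding openin_product_topology_alt by (metis lessThan_iff)
  \<comment> \<open>By continuity of \<open>H\<close>, a basic neighbourhood of \<open>u i\<close>
    is mapped into \<open>W i\<close>. Its principal elements translate this into a statement about
    \<open>h\<close> on a member of \<open>u i\<close>.\<close>
  have "\<forall>i. \<exists>A. i < n \<longrightarrow> A \<in> u i \<and> (\<forall>x\<in>A. x \<in> X \<and> h x \<in> W i)"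
  proof (intro allI)
    fix i
    show "\<exists>A. i < n \<longrightarrow> A \<in> u i \<and> (\<forall>x\<in>A. x \<in> X \<and> h x \<in> W i)"
    proof (cases "i < n")
      case True
      have ui: "u i \<in> ultrafilters X" using ut True by auto
      have "H (u i) \<in> W i" using W(2) True by (auto simp: PiE_iff map_tuple_apply)
      then have mem: "u i \<in> {v \<in> topspace (ultrafilter_topology X). H v \<in> W i}" using ui by simp
      have op: "openin (ultrafilter_topology X) {v \<in> topspace (ultrafilter_topology X). H v \<in> W i}"
        using H W(1)[OF True] unfolding continuous_map_def by blast
      obtain A where A: "A \<in> u i" "{v \<in> ultrafilters X. A \<in> v} \<subseteq> {v \<in> topspace (ultrafilter_topology X). H v \<in> W i}"
        by (rule ultrafilter_topology_base[OF op mem])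
      have AX: "A \<subseteq> X" using ultrafilter_subset[OF ui A(1)] .
      have "x \<in> X \<and> h x \<in> W i" if "x \<in> A" for x
      proof -
        have "x \<in> X" using AX that by blast
        then have "principal_on X x \<in> {v \<in> ultrafilters X. A \<in> v}"
          using that AX by (simp add: principal_on_iff principal_on_ultrafilter)
        then have "H (principal_on X x) \<in> W i" using A(2) by blast
        then show ?thesis using Hp \<open>x \<in> X\<close> by simp
      qed
      then show ?thesis using A(1) by blast
    qed simp
  qed
  then obtain A where A: "\<And>i. i < n \<Longrightarrow> A i \<in> u i" "\<And>i x. i < n \<Longrightarrow> x \<in> A i \<Longrightarrow> x \<in> X \<and> h x \<in> W i"
    by metis
  have "Q \<inter> (\<Pi>\<^sub>E i\<in>{..<n}. A i) \<noteq> {}" by (rule rel_starD[OF u A(1)])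
  then obtain a where a: "a \<in> Q" "a \<in> (\<Pi>\<^sub>E i\<in>{..<n}. A i)" by blast
  have "a \<in> tuples X n" using a(2) A(2) by (auto simp: PiE_iff)
  then have "map_tuple n h a \<in> S" using hom a(1) by blast
  moreover have "map_tuple n h a \<in> Pi\<^sub>E {..<n} W"
    using a(2) A(2) by (auto simp: PiE_iff map_tuple_def)
  ultimately show False using W(3) by blast
qed

text \<open>Only symbols of \<open>\<Sigma>\<close> are compared, since the limits are computed only
  for these.\<close>

lemma homomorphism_cong:
  assumes "universe \<AA> = universe \<AA>'"
    and "\<And>F. F \<in> fun_symbols \<Sigma> \<Longrightarrow> fun_int \<AA> F = fun_int \<AA>' F"
    and "\<And>R. R \<in> pred_symbols \<Sigma> \<Longrightarrow> pred_int \<AA> R = pred_int \<AA>' R"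
  shows "homomorphism \<Sigma> \<AA> \<CC> h \<longleftrightarrow> homomorphism \<Sigma> \<AA>' \<CC> h"
  using assms unfolding homomorphism_def by auto

lemma homomorphism_star_if_homomorphism:
  assumes T: "compact_space T" "Hausdorff_space T" and h: "h \<in> universe \<AA> \<rightarrow> topspace T"
    and univ: "universe \<CC> = topspace T"
    and f: "\<And>F. F \<in> fun_symbols \<Sigma> \<Longrightarrow> fun_int \<AA> F \<in> operations (universe \<AA>) (fun_arity \<Sigma> F)"
    and G: "\<And>F. F \<in> fun_symbols \<Sigma> \<Longrightarrow>
        fun_int \<CC> F \<in> right_continuous T (h ` universe \<AA>) (fun_arity \<Sigma> F) T"
    and S: "\<And>R. R \<in> pred_symbols \<Sigma> \<Longrightarrow>
        closedin (product_topology (\<lambda>_. T) {..<pred_arity \<Sigma> R}) (pred_int \<CC> R)"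
    and hom: "homomorphism \<Sigma> \<AA> \<CC> h"
  shows "homomorphism \<Sigma> (star_model \<Sigma> \<AA>) \<CC> (continuous_extension (universe \<AA>) T h)"
  unfolding homomorphism_def star_model_def model.simps
proof (intro conjI ballI impI)
  show "continuous_extension (universe \<AA>) T h \<in> ultrafilters (universe \<AA>) \<rightarrow> universe \<CC>"
    using continuous_map_funspace[OF continuous_map_continuous_extension[OF T h]] univ by simp
next
  fix F u assume F: "F \<in> fun_symbols \<Sigma>" and u: "u \<in> tuples (ultrafilters (universe \<AA>)) (fun_arity \<Sigma> F)"
  show "continuous_extension (universe \<AA>) T h (fun_tilde (universe \<AA>) (fun_arity \<Sigma> F) (fun_int \<AA> F) u) =
      fun_int \<CC> F (map_tuple (fun_arity \<Sigma> F) (continuous_extension (universe \<AA>) T h) u)"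
    using hom F unfolding homomorphism_def
    by (intro continuous_extension_fun_tilde[OF T h f[OF F] G[OF F] _ u]) blast
next
  fix R u assume R: "R \<in> pred_symbols \<Sigma>"
    and u: "u \<in> rel_star (universe \<AA>) (pred_arity \<Sigma> R) (pred_int \<AA> R)"
  show "map_tuple (pred_arity \<Sigma> R) (continuous_extension (universe \<AA>) T h) u \<in> pred_int \<CC> R"
    using hom R unfolding homomorphism_def
    by (intro continuous_extension_rel_star[OF T h S[OF R] _ u]) blast
qed

text \<open>The two models share their operations, and the tilde model has the smaller relations, so
  it has fewer conditions to meet.\<close>

lemma homomorphism_tilde_if_homomorphism_star:
  assumes "homomorphism \<Sigma> (star_model \<Sigma> \<AA>) \<CC> h"
  shows "homomorphism \<Sigma> (tilde_model \<Sigma> \<AA>) \<CC> h"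
  unfolding homomorphism_def tilde_model_def model.simps
proof (intro conjI ballI impI)
  fix R u assume R: "R \<in> pred_symbols \<Sigma>"
    and u: "u \<in> tuples (ultrafilters (universe \<AA>)) (pred_arity \<Sigma> R)"
    and "u \<in> rel_tilde (universe \<AA>) (pred_arity \<Sigma> R) (pred_int \<AA> R)"
  then have "u \<in> rel_star (universe \<AA>) (pred_arity \<Sigma> R) (pred_int \<AA> R)"
    by (intro rel_tilde_subset_rel_star[THEN subsetD])
  then show "map_tuple (pred_arity \<Sigma> R) h u \<in> pred_int \<CC> R"
    using assms R u by (simp add: homomorphism_def star_model_def)
qed (use assms in \<open>simp_all add: homomorphism_def star_model_def\<close>)

text \<open>\<open>principal_on\<close> embeds \<open>\<AA>\<close> into its tilde model, and
  \<open>H\<close> restricted along this embedding is \<open>h\<close>.\<close>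

lemma homomorphism_if_homomorphism_tilde:
  assumes h: "h \<in> universe \<AA> \<rightarrow> universe \<CC>"
    and H: "\<And>x. x \<in> universe \<AA> \<Longrightarrow> H (principal_on (universe \<AA>) x) = h x"
    and f: "\<And>F. F \<in> fun_symbols \<Sigma> \<Longrightarrow> fun_int \<AA> F \<in> operations (universe \<AA>) (fun_arity \<Sigma> F)"
    and hom: "homomorphism \<Sigma> (tilde_model \<Sigma> \<AA>) \<CC> H"
  shows "homomorphism \<Sigma> \<AA> \<CC> h"
proof -
  let ?X = "universe \<AA>"
  let ?p = "\<lambda>n. map_tuple n (principal_on ?X)"
  have p: "?p n a \<in> tuples (ultrafilters ?X) n" if "a \<in> tuples ?X n" for n a
    by (rule map_tuple_in_tuples[OF principal_on_funcset that])
  have Hp: "map_tuple n H (?p n a) = map_tuple n h a" if "a \<in> tuples ?X n" for n a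
    by (rule map_tuple_cong) (use that H in \<open>auto simp: map_tuple_apply\<close>)
  show ?thesis
    unfolding homomorphism_def
  proof (intro conjI ballI impI)
    fix F a assume F: "F \<in> fun_symbols \<Sigma>" and a: "a \<in> tuples ?X (fun_arity \<Sigma> F)"
    let ?n = "fun_arity \<Sigma> F"
    have "H (fun_tilde ?X ?n (fun_int \<AA> F) (?p ?n a)) = fun_int \<CC> F (map_tuple ?n H (?p ?n a))"
      using hom F p[OF a] unfolding homomorphism_def tilde_model_def model.simps by blast
    moreover have "fun_int \<AA> F a \<in> ?X" using f[OF F] a by auto
    ultimately show "h (fun_int \<AA> F a) = fun_int \<CC> F (map_tuple ?n h a)"
      by (simp only: fun_tilde_principal[OF f[OF F] a] Hp[OF a] H)
  next
    fix R a assume R: "R \<in> pred_symbols \<Sigma>" and a: "a \<in> tuples ?X (pred_arity \<Sigma> R)"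
      and "a \<in> pred_int \<AA> R"
    let ?n = "pred_arity \<Sigma> R"
    have "?p ?n a \<in> rel_tilde ?X ?n (pred_int \<AA> R)"
      using rel_tilde_principal[OF a] \<open>a \<in> pred_int \<AA> R\<close> by blast
    then have "map_tuple ?n H (?p ?n a) \<in> pred_int \<CC> R"
      using hom R p[OF a] unfolding homomorphism_def tilde_model_def model.simps by blast
    then show "map_tuple ?n h a \<in> pred_int \<CC> R" by (simp only: Hp[OF a])
  qed (rule h)
qed


section \<open>The principal submodel\<close>

lemma universe_principal_submodel: "universe (principal_submodel \<Sigma> \<BB>) = base \<BB>"
  by (simp add: principal_submodel_def Let_def)

text \<open>\<open>e_rel\<close> gives the tilde extension of the limit relation, and on principal
  tuples this is the limit relation itself.\<close>

lemma pred_int_principal_submodel: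
  assumes "is_narrow_model \<Sigma> \<BB>" "R \<in> pred_symbols \<Sigma>"
  shows "pred_int (principal_submodel \<Sigma> \<BB>) R = limit_relation (base \<BB>) (pred_arity \<Sigma> R) (narrow_pred \<BB> R)"
proof -
  have "narrow_pred \<BB> R \<in> ultrafilters (relations (base \<BB>) (pred_arity \<Sigma> R))"
    using assms unfolding is_narrow_model_def by blast
  then show ?thesis
    using limit_relation_in_relations[of "base \<BB>" "pred_arity \<Sigma> R" "narrow_pred \<BB> R"]
    by (auto simp: principal_submodel_def Let_def e_model_def e_rel_eq rel_tilde_principal)
qed

text \<open>At a principal tuple \<open>e_fun\<close> returns the evaluation ultrafilter.
  Pseudo-principality makes it principal, so \<open>inv_into\<close> in
  \<open>principal_submodel\<close> picks its actual point in \<open>X\<close>.\<close>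

lemma
  assumes "is_narrow_model \<Sigma> \<BB>" "pseudo_principal_on_funs \<Sigma> \<BB>" and F: "F \<in> fun_symbols \<Sigma>"
  shows eval_ultrafilter_narrow_fun: "a \<in> tuples (base \<BB>) (fun_arity \<Sigma> F) \<Longrightarrow>
      eval_ultrafilter (base \<BB>) (fun_arity \<Sigma> F) (narrow_fun \<BB> F) a =
        principal_on (base \<BB>) (fun_int (principal_submodel \<Sigma> \<BB>) F a)"
    and fun_int_principal_submodel:
      "fun_int (principal_submodel \<Sigma> \<BB>) F \<in> operations (base \<BB>) (fun_arity \<Sigma> F)"
proof -
  let ?X = "base \<BB>" and ?n = "fun_arity \<Sigma> F" and ?f = "fun_int (principal_submodel \<Sigma> \<BB>) F"
  let ?E = "eval_ultrafilter ?X ?n (narrow_fun \<BB> F)"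
  have \<ff>: "narrow_fun \<BB> F \<in> ultrafilters (operations ?X ?n)"
    using assms unfolding is_narrow_model_def by blast
  have f: "?f = (\<lambda>x\<in>tuples ?X ?n. inv_into ?X (principal_on ?X) (?E x))"
    by (simp add: principal_submodel_def Let_def e_model_def e_fun_eq[OF \<ff>]
        right_extension_principal[OF eval_ultrafilter_funcset[OF \<ff>]] cong: restrict_cong)
  have *: "?f a \<in> ?X \<and> ?E a = principal_on ?X (?f a)" if a: "a \<in> tuples ?X ?n" for a
  proof -
    obtain b where "b \<in> ?X" "?E a = principal_on ?X b"
      using assms(2) F a unfolding pseudo_principal_on_funs_def eval_ultrafilter_def image_ultrafilter_def
      by blast
    then show ?thesis using a by (simp add: f inv_into_f_f[OF inj_on_principal_on])
  qed
  then show "?E a = principal_on ?X (?f a)" if "a \<in> tuples ?X ?n" for a using that by blast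
  show "?f \<in> operations ?X ?n"
    using * by (intro PiE_I) (auto simp: f)
qed

text \<open>On the symbols of \<open>\<Sigma>\<close> the limit of the wide model is the star model
  of the principal submodel, so conditions (ii) and (iv) coincide.\<close>

lemma homomorphism_limit_I_model_iff:
  assumes "is_narrow_model \<Sigma> \<BB>" "pseudo_principal_on_funs \<Sigma> \<BB>"
  shows "homomorphism \<Sigma> (limit_model \<Sigma> (RC_topology (base \<BB>)) (RegCl_topology (base \<BB>)) (I_model \<Sigma> \<BB>)) \<CC> H
    \<longleftrightarrow> homomorphism \<Sigma> (star_model \<Sigma> (principal_submodel \<Sigma> \<BB>)) \<CC> H"
proof (rule homomorphism_cong)
  fix F assume F: "F \<in> fun_symbols \<Sigma>"
  have "narrow_fun \<BB> F \<in> ultrafilters (operations (base \<BB>) (fun_arity \<Sigma> F))"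
    using assms F unfolding is_narrow_model_def by blast
  from ultra_limit_I_fun[OF this fun_int_principal_submodel[OF assms F] eval_ultrafilter_narrow_fun[OF assms F]]
  show "fun_int (limit_model \<Sigma> (RC_topology (base \<BB>)) (RegCl_topology (base \<BB>)) (I_model \<Sigma> \<BB>)) F =
      fun_int (star_model \<Sigma> (principal_submodel \<Sigma> \<BB>)) F"
    by (simp add: limit_model_def I_model_def star_model_def universe_principal_submodel)
next
  fix R assume R: "R \<in> pred_symbols \<Sigma>"
  have "narrow_pred \<BB> R \<in> ultrafilters (relations (base \<BB>) (pred_arity \<Sigma> R))"
    using assms R unfolding is_narrow_model_def by blast
  from ultra_limit_I_rel[OF this]
  show "pred_int (limit_model \<Sigma> (RC_topology (base \<BB>)) (RegCl_topology (base \<BB>)) (I_model \<Sigma> \<BB>)) R =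
      pred_int (star_model \<Sigma> (principal_submodel \<Sigma> \<BB>)) R"
    by (simp add: limit_model_def I_model_def star_model_def universe_principal_submodel
        pred_int_principal_submodel[OF assms(1) R])
qed (simp add: limit_model_def I_model_def star_model_def universe_principal_submodel)

theorem theorem50:
  fixes \<Sigma> :: "('f, 'p) signature"
    and \<BB> :: "('a, 'f, 'p) narrow_model"
    and \<VV> :: "('b, 'f, 'p) wide_model"
    and X :: "'a set"
    and Y :: "'b set"
    and \<AA> :: "('a, 'f, 'p) model"
    and \<UU> :: "('a set set, 'f, 'p) wide_model"
    and limV :: "('b, 'f, 'p) model"
    and TY :: "'b topology"
    and TF :: "nat \<Rightarrow> ((nat \<Rightarrow> 'b) \<Rightarrow> 'b) topology"
    and TP :: "nat \<Rightarrow> (nat \<Rightarrow> 'b) set topology"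
    and h :: "'a \<Rightarrow> 'b"
    and h_tilde :: "'a set set \<Rightarrow> 'b"
  defines "X \<equiv> base \<BB>"
    and "Y \<equiv> wide_universe \<VV>"
    and "\<AA> \<equiv> principal_submodel \<Sigma> \<BB>"
    and "\<UU> \<equiv> I_model \<Sigma> \<BB>"
    and "limV \<equiv> limit_model \<Sigma> TF TP \<VV>"
    and "h_tilde \<equiv> continuous_extension X TY h"
  assumes "is_narrow_model \<Sigma> \<BB>"
    and "pseudo_principal_on_funs \<Sigma> \<BB>"
    and "is_wide_model \<Sigma> \<VV>"
    and "topspace TY = Y"
    and "compact_space TY"
    and "Hausdorff_space TY"
    and "\<And>n. topspace (TF n) = operations Y n"
    and "\<And>n. topspace (TP n) = relations Y n"
    and "h \<in> X \<rightarrow> Y"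
    and "\<And>F. F \<in> fun_symbols \<Sigma> \<Longrightarrow>
           has_ultra_limit (TF (fun_arity \<Sigma> F)) (wide_fun \<VV> F) \<and>
           ultra_limit (TF (fun_arity \<Sigma> F)) (wide_fun \<VV> F)
             \<in> right_continuous TY (h ` X) (fun_arity \<Sigma> F) TY"
    and "\<And>R. R \<in> pred_symbols \<Sigma> \<Longrightarrow>
           has_ultra_limit (TP (pred_arity \<Sigma> R)) (wide_pred \<VV> R) \<and>
           closedin (product_topology (\<lambda>_. TY) {..<pred_arity \<Sigma> R})
             (ultra_limit (TP (pred_arity \<Sigma> R)) (wide_pred \<VV> R))"
  shows "(homomorphism \<Sigma> \<AA> limV h \<longleftrightarrow>
            homomorphism \<Sigma> (limit_model \<Sigma> (RC_topology X) (RegCl_topology X) \<UU>) limV h_tilde) \<and>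
         (homomorphism \<Sigma> (limit_model \<Sigma> (RC_topology X) (RegCl_topology X) \<UU>) limV h_tilde \<longleftrightarrow>
            homomorphism \<Sigma> (tilde_model \<Sigma> \<AA>) limV h_tilde) \<and>
         (homomorphism \<Sigma> (tilde_model \<Sigma> \<AA>) limV h_tilde \<longleftrightarrow>
            homomorphism \<Sigma> (star_model \<Sigma> \<AA>) limV h_tilde)"
proof -
  \<comment> \<open>The six defining equations come first among the assumptions, so the hypotheses
    on \<open>\<BB>\<close> start at the seventh.\<close>
  note \<BB> = assms(7,8) and univ = assms(10) and T = assms(11,12) and F_lim = assms(16) and R_lim = assms(17)
  have limV: "universe limV = topspace TY" using univ by (simp add: limV_def limit_model_def Y_def)
  have X: "universe \<AA> = X" by (simp add: \<AA>_def X_def universe_principal_submodel)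
  have h: "h \<in> universe \<AA> \<rightarrow> topspace TY" using assms(15) univ X by simp
  have f: "fun_int \<AA> F \<in> operations (universe \<AA>) (fun_arity \<Sigma> F)" if "F \<in> fun_symbols \<Sigma>" for F
    using fun_int_principal_submodel[OF \<BB> that] unfolding X unfolding \<AA>_def X_def .
  have h_tilde: "h_tilde = continuous_extension (universe \<AA>) TY h" by (simp add: h_tilde_def X)
  \<comment> \<open>The cycle runs from (i) to (iv) to (iii) and back to (i); (ii) is attached to
    (iv).\<close>
  have "homomorphism \<Sigma> (star_model \<Sigma> \<AA>) limV h_tilde" if "homomorphism \<Sigma> \<AA> limV h"
    unfolding h_tilde
  proof (rule homomorphism_star_if_homomorphism[OF T h limV f _ _ that])
    show "fun_int limV F \<in> right_continuous TY (h ` universe \<AA>) (fun_arity \<Sigma> F) TY"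
      if "F \<in> fun_symbols \<Sigma>" for F
      using F_lim[OF that] by (simp add: limV_def limit_model_def X)
    show "closedin (product_topology (\<lambda>_. TY) {..<pred_arity \<Sigma> R}) (pred_int limV R)"
      if "R \<in> pred_symbols \<Sigma>" for R
      using R_lim[OF that] by (simp add: limV_def limit_model_def)
  qed
  moreover have "homomorphism \<Sigma> \<AA> limV h" if "homomorphism \<Sigma> (tilde_model \<Sigma> \<AA>) limV h_tilde"
  proof (rule homomorphism_if_homomorphism_tilde[OF _ _ f that])
    show "h \<in> universe \<AA> \<rightarrow> universe limV" using h limV by simp
    show "h_tilde (principal_on (universe \<AA>) x) = h x" if "x \<in> universe \<AA>" for x
      unfolding h_tilde by (rule continuous_extension_principal_on[OF T h that])
  qed
  moreover have "homomorphism \<Sigma> (limit_model \<Sigma> (RC_topology X) (RegCl_topology X) \<UU>) limV h_tilde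
      \<longleftrightarrow> homomorphism \<Sigma> (star_model \<Sigma> \<AA>) limV h_tilde"
    unfolding X_def \<UU>_def \<AA>_def by (rule homomorphism_limit_I_model_iff[OF \<BB>])
  ultimately show ?thesis
    using homomorphism_tilde_if_homomorphism_star by blast
qed

end
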